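(* Let $(K,v)$ be a henselian valued field and let $[\Phi_0,\dots,\Phi_r,\Phi_{r+1}=\{F\}]$ be an Okutsu frame of some monic irreducible $F\in K[x]$ of degree $>1$, with $m_\ell$ the common degree of the polynomials in $\Phi_\ell$. Then $1=m_0\mid m_1\mid\cdots\mid m_r\mid\deg(F)$.
   Context: $v$ also denotes its unique extension to an algebraic closure $\overline K$ of $K$. For $F\in K[x]$ monic irreducible, $v_F(f)=v(f(\theta))$ for $f\in K[x]$, with $\theta\in\overline K$ any root of $F$. **Okutsu frames.** Let $n=\deg F>1$. For non-constant $g$ put $\mathrm{wt}(g)=v_F(g)/\deg(g)\in\Gamma_{\mathbb{Q}}\cup\{\infty\}$, where $\Gamma_{\mathbb{Q}}=v(K^* )\otimes\mathbb{Q}$. For $1<m\le n$ let $W_m=\{\mathrm{wt}(g)\mid g\in K[x]\text{ monic},\ 0<\deg g<m\}$. An Okutsu frame of $F$ is a list $[\Phi_0,\dots,\Phi_r,\Phi_{r+1}=\{F\}]$ of nonempty sets of monic irreducible polynomials such that all polynomials in $\Phi_\ell$ have the same degree $m_\ell$, $1=m_0<m_1<\cdots<m_{r+1}=n$, and for every $0\le\ell\le r$ and every monic $g$ with $0<\deg g<m_{\ell+1}$ there is $\phi\in\Phi_\ell$ with $\mathrm{wt}(g)\le\mathrm{wt}(\phi)$. Okutsu frames are always assumed to satisfy moreover, for $0\le\ell\le r$: (OF1) $\#\Phi_\ell=1$ whenever $\max(W_{m_{\ell+1}})$ exists; (OF2) if $\max(W_{m_{\ell+1}})$ does not exist, $\Phi_\ell$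 is totally ordered by $\phi<\phi'\iff v_F(\phi)<v_F(\phi')$ (distinct elements have distinct $v_F$-values); (OF3) $\mathrm{wt}(\phi)<\mathrm{wt}(\varphi)$ for all $\phi\in\Phi_\ell$, $\varphi\in\Phi_{\ell+1}$. *)

theory Defs
  imports
    "HOL-Library.Extended"
    "HOL-Algebra.Algebraic_Closure_Type"
begin

section \<open>The divisible hull of an ordered abelian group\<close>

primrec nsmul :: "nat \<Rightarrow> 'g::monoid_add \<Rightarrow> 'g" where
  "nsmul 0 a = 0"
| "nsmul (Suc n) a = a + nsmul n a"

lemma nsmul_1 [simp]: "nsmul (Suc 0) a = a"
  by simp

lemma nsmul_zero_right [simp]: "nsmul n 0 = 0"
  by (induction n) auto

lemma nsmul_add_left: "nsmul (m + n) (a::'g::monoid_add) = nsmul m a + nsmul n a"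
  by (induction m) (auto simp: add.assoc)

lemma nsmul_add: "nsmul n (a + b :: 'g::comm_monoid_add) = nsmul n a + nsmul n b"
  by (induction n) (auto simp: ac_simps)

lemma nsmul_uminus: "nsmul n (- a :: 'g::ab_group_add) = - nsmul n a"
  by (induction n) auto

lemma nsmul_nsmul: "nsmul m (nsmul n (a::'g::comm_monoid_add)) = nsmul (m * n) a"
  by (induction m) (auto simp: nsmul_add_left)

lemma nsmul_strict_mono:
  fixes a b :: "'g::linordered_ab_group_add"
  assumes "a < b" "n > 0"
  shows "nsmul n a < nsmul n b"
  using assms(2)
proof (induction n)
  case (Suc n)
  show ?case
  proof (cases "n = 0")
    case True
    with assms(1) show ?thesis by simp
  next
    case False
    with Suc have "nsmul n a < nsmul n b" by simp
    with assms(1) show ?thesis by (simp add: add_strict_mono)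
  qed
qed simp

lemma nsmul_less_iff:
  fixes a b :: "'g::linordered_ab_group_add"
  assumes "n > 0"
  shows "nsmul n a < nsmul n b \<longleftrightarrow> a < b"
  using nsmul_strict_mono[OF _ assms, of a b] nsmul_strict_mono[OF _ assms, of b a]
  by (cases a b rule: linorder_cases) auto

lemma nsmul_le_iff:
  fixes a b :: "'g::linordered_ab_group_add"
  assumes "n > 0"
  shows "nsmul n a \<le> nsmul n b \<longleftrightarrow> a \<le> b"
  using nsmul_less_iff[OF assms, of b a] by (simp add: linorder_not_less[symmetric])

lemma nsmul_eq_iff:
  fixes a b :: "'g::linordered_ab_group_add"
  assumes "n > 0"
  shows "nsmul n a = nsmul n b \<longleftrightarrow> a = b"
  using nsmul_le_iff[OF assms, of a b] nsmul_le_iff[OF assms, of b a] by (auto simp: order_eq_iff)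

text \<open>
  For \<open>\<Gamma>\<close> the group \<open>'g\<close>, the type \<open>'g dhull\<close> is \<open>\<Gamma> \<otimes> \<rat>\<close>: since \<open>\<Gamma>\<close> is
  torsion-free, this is the group of fractions \<open>a / m\<close> with \<open>m\<close> a positive integer.
\<close>

definition dhull_rel :: "'g::linordered_ab_group_add \<times> nat \<Rightarrow> 'g \<times> nat \<Rightarrow> bool" where
  "dhull_rel = (\<lambda>(a, m) (b, n). m > 0 \<and> n > 0 \<and> nsmul n a = nsmul m b)"

lemma part_equivp_dhull_rel: "part_equivp (dhull_rel :: 'g::linordered_ab_group_add \<times> nat \<Rightarrow> _)"
proof (rule part_equivpI)
  show "\<exists>x :: 'g \<times> nat. dhull_rel x x"
    by (rule exI[of _ "(0, 1)"]) (simp add: dhull_rel_def)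
  show "symp (dhull_rel :: 'g \<times> nat \<Rightarrow> _)"
    by (rule sympI) (auto simp: dhull_rel_def)
  show "transp (dhull_rel :: 'g \<times> nat \<Rightarrow> _)"
  proof (rule transpI)
    fix x y z :: "'g \<times> nat"
    assume 1: "dhull_rel x y" and 2: "dhull_rel y z"
    obtain a m b n c k where x: "x = (a, m)" and y: "y = (b, n)" and z: "z = (c, k)"
      by (metis surj_pair)
    from 1 2 have pos: "m > 0" "n > 0" "k > 0"
      and ab: "nsmul n a = nsmul m b" and bc: "nsmul k b = nsmul n c"
      by (auto simp: dhull_rel_def x y z)
    have "nsmul n (nsmul k a) = nsmul k (nsmul n a)"
      by (simp add: nsmul_nsmul mult.commute)
    also have "\<dots> = nsmul m (nsmul k b)"
      by (simp add: ab nsmul_nsmul mult.commute)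
    also have "\<dots> = nsmul n (nsmul m c)"
      by (simp add: bc nsmul_nsmul mult.commute)
    finally show "dhull_rel x z"
      using pos by (simp add: dhull_rel_def nsmul_eq_iff x z)
  qed
qed

quotient_type (overloaded) 'g dhull = "'g::linordered_ab_group_add \<times> nat" / partial: dhull_rel
  by (rule part_equivp_dhull_rel)

lemma dhull_cross_mult:
  assumes "dhull_rel (a, m) (a', m')" "dhull_rel (b, n) (b', n')"
  shows "nsmul (m' * n') (nsmul n a) = nsmul (m * n) (nsmul n' a')"
    and "nsmul (m' * n') (nsmul m b) = nsmul (m * n) (nsmul m' b')"
proof -
  have a: "nsmul m' a = nsmul m a'" and b: "nsmul n' b = nsmul n b'"
    using assms by (auto simp: dhull_rel_def)
  have "nsmul (m' * n') (nsmul n a) = nsmul (n' * n) (nsmul m' a)"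
    by (simp add: nsmul_nsmul ac_simps)
  also have "\<dots> = nsmul (m * n) (nsmul n' a')"
    by (simp add: a nsmul_nsmul ac_simps)
  finally show "nsmul (m' * n') (nsmul n a) = nsmul (m * n) (nsmul n' a')" .
  have "nsmul (m' * n') (nsmul m b) = nsmul (m' * m) (nsmul n' b)"
    by (simp add: nsmul_nsmul ac_simps)
  also have "\<dots> = nsmul (m * n) (nsmul m' b')"
    by (simp add: b nsmul_nsmul ac_simps)
  finally show "nsmul (m' * n') (nsmul m b) = nsmul (m * n) (nsmul m' b')" .
qed

instantiation dhull :: (linordered_ab_group_add) linordered_ab_group_add
begin

lift_definition zero_dhull :: "'a dhull" is "(0, 1)"
  by (simp add: dhull_rel_def)

lift_definition plus_dhull :: "'a dhull \<Rightarrow> 'a dhull \<Rightarrow> 'a dhull"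
  is "\<lambda>(a, m) (b, n). (nsmul n a + nsmul m b, m * n)"
proof clarify
  fix a m a' m' b n b' n'
  assume *: "dhull_rel (a :: 'a, m) (a', m')" "dhull_rel (b :: 'a, n) (b', n')"
  then have "m > 0" "m' > 0" "n > 0" "n' > 0"
    by (auto simp: dhull_rel_def)
  with dhull_cross_mult[OF *]
  show "dhull_rel (nsmul n a + nsmul m b, m * n) (nsmul n' a' + nsmul m' b', m' * n')"
    by (simp add: dhull_rel_def nsmul_add)
qed

lift_definition uminus_dhull :: "'a dhull \<Rightarrow> 'a dhull" is "\<lambda>(a, m). (- a, m)"
  by (auto simp: dhull_rel_def nsmul_uminus)

definition minus_dhull :: "'a dhull \<Rightarrow> 'a dhull \<Rightarrow> 'a dhull" where
  "minus_dhull x y = x + - y"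

lift_definition less_eq_dhull :: "'a dhull \<Rightarrow> 'a dhull \<Rightarrow> bool"
  is "\<lambda>(a, m) (b, n). nsmul n a \<le> nsmul m b"
proof clarify
  fix a m a' m' b n b' n'
  assume *: "dhull_rel (a :: 'a, m) (a', m')" "dhull_rel (b :: 'a, n) (b', n')"
  then have pos: "m * n > 0" "m' * n' > 0"
    by (auto simp: dhull_rel_def)
  show "nsmul n a \<le> nsmul m b \<longleftrightarrow> nsmul n' a' \<le> nsmul m' b'"
    using nsmul_le_iff[OF pos(1), of "nsmul n' a'" "nsmul m' b'"]
      nsmul_le_iff[OF pos(2), of "nsmul n a" "nsmul m b"]
    by (simp add: dhull_cross_mult[OF *])
qed

definition less_dhull :: "'a dhull \<Rightarrow> 'a dhull \<Rightarrow> bool" where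
  "less_dhull x y \<longleftrightarrow> x \<le> y \<and> \<not> y \<le> x"

instance
proof
  fix x y z :: "'a dhull"
  show "x + y + z = x + (y + z)"
    by transfer (auto simp: dhull_rel_def nsmul_add nsmul_nsmul ac_simps)
  show "x + y = y + x"
    by transfer (auto simp: dhull_rel_def nsmul_add nsmul_nsmul ac_simps)
  show "0 + x = x"
    by transfer (auto simp: dhull_rel_def)
  show "- x + x = 0"
    by transfer (auto simp: dhull_rel_def nsmul_uminus)
  show "x - y = x + - y"
    by (rule minus_dhull_def)
  show "x < y \<longleftrightarrow> x \<le> y \<and> \<not> y \<le> x"
    by (rule less_dhull_def)
  show "x \<le> x"
    by transfer auto
  show "x \<le> y \<or> y \<le> x"
    by transfer auto
  show "x = y" if "x \<le> y" "y \<le> x"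
    using that by transfer (auto simp: dhull_rel_def)
  show "x \<le> z" if "x \<le> y" "y \<le> z"
    using that
  proof (transfer, clarify)
    fix a m b n c k
    assume "dhull_rel (a :: 'a, m) (a, m)" "dhull_rel (b :: 'a, n) (b, n)"
      "dhull_rel (c :: 'a, k) (c, k)" and ab: "nsmul n a \<le> nsmul m b" and bc: "nsmul k b \<le> nsmul n c"
    then have pos: "m > 0" "n > 0" "k > 0"
      by (auto simp: dhull_rel_def)
    have "nsmul n (nsmul k a) = nsmul k (nsmul n a)"
      by (simp add: nsmul_nsmul ac_simps)
    also have "\<dots> \<le> nsmul k (nsmul m b)"
      using ab pos by (simp only: nsmul_le_iff)
    also have "\<dots> = nsmul m (nsmul k b)"
      by (simp add: nsmul_nsmul ac_simps)
    also have "\<dots> \<le> nsmul m (nsmul n c)"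
      using bc pos by (simp only: nsmul_le_iff)
    also have "\<dots> = nsmul n (nsmul m c)"
      by (simp add: nsmul_nsmul ac_simps)
    finally show "nsmul k a \<le> nsmul m c"
      using pos by (simp only: nsmul_le_iff)
  qed
  show "z + x \<le> z + y" if "x \<le> y"
    using that
  proof (transfer, clarify)
    fix a m b n c k
    assume "dhull_rel (a :: 'a, m) (a, m)" "dhull_rel (b :: 'a, n) (b, n)"
      "dhull_rel (c :: 'a, k) (c, k)" and ab: "nsmul n a \<le> nsmul m b"
    then have pos: "m > 0" "n > 0" "k > 0"
      by (auto simp: dhull_rel_def)
    have "nsmul (k * k) (nsmul n a) \<le> nsmul (k * k) (nsmul m b)"
      using ab pos by (simp only: nsmul_le_iff nat_0_less_mult_iff)
    then show "nsmul (k * n) (nsmul m c + nsmul k a) \<le> nsmul (k * m) (nsmul n c + nsmul k b)"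
      by (simp add: nsmul_add nsmul_nsmul ac_simps)
  qed
qed

end

lift_definition to_dhull :: "'g::linordered_ab_group_add \<Rightarrow> 'g dhull" is "\<lambda>a. (a, 1)"
  by (simp add: dhull_rel_def)

text \<open>Division by a positive integer; \<open>x / 0 = 0\<close> by convention.\<close>

lift_definition dhull_div :: "'g::linordered_ab_group_add dhull \<Rightarrow> nat \<Rightarrow> 'g dhull"
  is "\<lambda>(a, m) d. if d = 0 then (0, 1) else (a, d * m)"
proof clarify
  fix a a' :: 'g and m m' d :: nat
  assume "dhull_rel (a, m) (a', m')"
  then have *: "m > 0" "m' > 0" "nsmul m' a = nsmul m a'"
    by (auto simp: dhull_rel_def)
  then have "nsmul (d * m') a = nsmul (d * m) a'"
    by (simp only: nsmul_nsmul[symmetric])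
  with * show "dhull_rel (if d = 0 then (0, 1) else (a, d * m))
      (if d = 0 then (0, 1) else (a', d * m'))"
    by (simp add: dhull_rel_def)
qed

lemma to_dhull_add: "to_dhull (a + b) = to_dhull a + to_dhull b"
  by transfer (simp add: dhull_rel_def)

lemma to_dhull_le_iff: "to_dhull a \<le> to_dhull b \<longleftrightarrow> a \<le> b"
  by transfer simp

lemma dhull_cases:
  obtains a m where "x = abs_dhull (a, m)" "m > 0"
proof -
  obtain a m where am: "rep_dhull x = (a, m)"
    by fastforce
  have "m > 0"
    using Quotient_rep_reflp[OF Quotient_dhull, of x] by (simp add: am dhull_rel_def)
  with Quotient_abs_rep[OF Quotient_dhull, of x] show ?thesis
    by (intro that[of a m]) (simp_all add: am)
qed

lemma abs_dhull_eqI: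
  assumes "m > 0" "n > 0" "nsmul n a = nsmul m b"
  shows "abs_dhull (a, m) = abs_dhull (b, n)"
  using assms by (intro Quotient_rel_abs[OF Quotient_dhull]) (simp add: dhull_rel_def)

lemma nsmul_abs_dhull:
  assumes "m > 0"
  shows "nsmul d (abs_dhull (a, m)) = abs_dhull (nsmul d a, m)"
proof (induction d)
  case 0
  show ?case
    using assms by (auto simp: zero_dhull_def intro: abs_dhull_eqI)
next
  case (Suc d)
  have "nsmul (Suc d) (abs_dhull (a, m)) = abs_dhull (a, m) + abs_dhull (nsmul d a, m)"
    by (simp add: Suc)
  also have "\<dots> = abs_dhull (nsmul m a + nsmul m (nsmul d a), m * m)"
    using assms by (simp add: plus_dhull.abs_eq dhull_rel_def)
  also have "\<dots> = abs_dhull (nsmul (Suc d) a, m)"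
    using assms by (intro abs_dhull_eqI) (simp_all add: nsmul_add nsmul_nsmul ac_simps)
  finally show ?case .
qed

lemma nsmul_dhull_div:
  assumes "d > 0"
  shows "nsmul d (dhull_div x d) = x"
proof -
  obtain a m where x: "x = abs_dhull (a, m)" "m > 0"
    by (rule dhull_cases)
  then have "dhull_div x d = abs_dhull (a, d * m)"
    using assms by (simp add: dhull_div.abs_eq dhull_rel_def)
  with x assms show ?thesis
    by (auto simp: nsmul_abs_dhull nsmul_nsmul ac_simps intro!: abs_dhull_eqI)
qed


section \<open>Henselian valued fields\<close>

text \<open>
  Krull valuations, written additively, of arbitrary rank.  Of the two infinite elements of
  \<open>'g extended\<close> only \<open>\<infinity>\<close> is allowed as a value; \<open>v\<close> need not be onto \<open>'g\<close>.
\<close>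

definition valuation :: "('a::field \<Rightarrow> 'g::linordered_ab_group_add extended) \<Rightarrow> bool" where
  "valuation v \<longleftrightarrow>
     (\<forall>x. v x \<noteq> Minf) \<and>
     (\<forall>x. v x = Pinf \<longleftrightarrow> x = 0) \<and>
     (\<forall>x y. v (x * y) = v x + v y) \<and>
     (\<forall>x y. min (v x) (v y) \<le> v (x + y))"

text \<open>
  As the algebraic closure is algebraic over the base field \<open>K\<close>, the value group of any
  extension of \<open>v\<close> is torsion over \<open>v(K\<^sup>*)\<close>, hence embeds uniquely (over \<open>v(K\<^sup>*)\<close>, preserving
  the order) into \<open>v(K\<^sup>*) \<otimes> \<rat>\<close>.  So extensions up to equivalence are the same as
  extensions with values in \<open>'g dhull\<close>, and \<open>henselian\<close> says that there is only one.
\<close>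

definition extends_valuation ::
  "('a::field alg_closure \<Rightarrow> 'g::linordered_ab_group_add dhull extended) \<Rightarrow>
   ('a \<Rightarrow> 'g extended) \<Rightarrow> bool" where
  "extends_valuation w v \<longleftrightarrow>
     valuation w \<and> (\<forall>x. w (to_ac x) = map_extended to_dhull (v x))"

definition henselian :: "('a::field \<Rightarrow> 'g::linordered_ab_group_add extended) \<Rightarrow> bool" where
  "henselian v \<longleftrightarrow> valuation v \<and> (\<exists>!w. extends_valuation w v)"

definition val_ac ::
  "('a::field \<Rightarrow> 'g::linordered_ab_group_add extended) \<Rightarrow>
   'a alg_closure \<Rightarrow> 'g dhull extended" where
  "val_ac v = (THE w. extends_valuation w v)"

lemma extends_valuation_val_ac:
  assumes "henselian v"
  shows "extends_valuation (val_ac v) v"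
  using theI'[of "\<lambda>w. extends_valuation w v"] assms
  unfolding henselian_def val_ac_def by blast


section \<open>Okutsu frames\<close>

text \<open>
  For \<open>v\<close> henselian and \<open>F\<close> irreducible, the value does not depend on the root of \<open>F\<close>,
  since the unique extension of \<open>v\<close> is invariant under automorphisms over the base field.
\<close>

definition val_poly ::
  "('a::field \<Rightarrow> 'g::linordered_ab_group_add extended) \<Rightarrow> 'a poly \<Rightarrow> 'a poly \<Rightarrow>
   'g dhull extended" where
  "val_poly v F f =
     val_ac v (poly (map_poly to_ac f) (SOME \<theta>. poly (map_poly to_ac F) \<theta> = 0))"

definition wt ::
  "('a::field \<Rightarrow> 'g::linordered_ab_group_add extended) \<Rightarrow> 'a poly \<Rightarrow> 'a poly \<Rightarrow>
   'g dhull extended" where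
  "wt v F g = map_extended (\<lambda>x. dhull_div x (Polynomial.degree g)) (val_poly v F g)"

definition wt_set ::
  "('a::field \<Rightarrow> 'g::linordered_ab_group_add extended) \<Rightarrow> 'a poly \<Rightarrow> nat \<Rightarrow>
   'g dhull extended set" where
  "wt_set v F m =
     {wt v F g | g. Polynomial.lead_coeff g = 1 \<and> 0 < Polynomial.degree g \<and>
                    Polynomial.degree g < m}"

definition has_max :: "'b::linorder set \<Rightarrow> bool" where
  "has_max A \<longleftrightarrow> (\<exists>x\<in>A. \<forall>y\<in>A. y \<le> x)"

text \<open>
  The list \<open>\<Phi>\<close> is \<open>[\<Phi>\<^sub>0, \<dots>, \<Phi>\<^sub>r, {F}]\<close>, and \<open>m l\<close> is the common degree of the polynomials in
  \<open>\<Phi> ! l\<close>; values of \<open>m\<close> beyond \<open>r + 1\<close> are irrelevant.  The last three conjuncts are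
  the additional conditions (OF1), (OF2) and (OF3); for (OF2), the strict relation by values is
  a total order on \<open>\<Phi> ! l\<close> exactly if distinct elements have distinct values.
\<close>

definition okutsu_frame ::
  "('a::field \<Rightarrow> 'g::linordered_ab_group_add extended) \<Rightarrow> 'a poly \<Rightarrow> nat \<Rightarrow>
   'a poly set list \<Rightarrow> (nat \<Rightarrow> nat) \<Rightarrow> bool" where
  "okutsu_frame v F r \<Phi> m \<longleftrightarrow>
     length \<Phi> = r + 2 \<and>
     \<Phi> ! (r + 1) = {F} \<and>
     (\<forall>l\<le>r + 1. \<Phi> ! l \<noteq> {} \<and>
        (\<forall>\<phi>\<in>\<Phi> ! l. Polynomial.lead_coeff \<phi> = 1 \<and> Factorial_Ring.irreducible \<phi> \<and>
                    Polynomial.degree \<phi> = m l)) \<and>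
     m 0 = 1 \<and>
     (\<forall>l\<le>r. m l < m (l + 1)) \<and>
     (\<forall>l\<le>r. \<forall>g. Polynomial.lead_coeff g = 1 \<and> 0 < Polynomial.degree g \<and>
                 Polynomial.degree g < m (l + 1) \<longrightarrow>
                 (\<exists>\<phi>\<in>\<Phi> ! l. wt v F g \<le> wt v F \<phi>)) \<and>
     (\<forall>l\<le>r. has_max (wt_set v F (m (l + 1))) \<longrightarrow> card (\<Phi> ! l) = 1) \<and>
     (\<forall>l\<le>r. \<not> has_max (wt_set v F (m (l + 1))) \<longrightarrow> inj_on (val_poly v F) (\<Phi> ! l)) \<and>
     (\<forall>l\<le>r. \<forall>\<phi>\<in>\<Phi> ! l. \<forall>\<psi>\<in>\<Phi> ! (l + 1). wt v F \<phi> < wt v F \<psi>)"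

end

theory Submission
  imports Defs
begin

text \<open>
  Let \<open>\<theta>\<close> be a root of \<open>F\<close>.  Comparing the weights of two irreducible polynomials amounts to comparing
  the distances of \<open>\<theta>\<close> to their closest roots.  So if \<open>x\<close> is a root of some \<open>\<phi> \<in> \<Phi>\<^sub>l\<close>
  closest to \<open>\<theta>\<close>, then the ball \<open>B\<close> around \<open>x\<close> with \<open>\<theta>\<close> on its boundary contains a root of each
  \<open>\<psi> \<in> \<Phi>\<^bsub>l+1\<^esub>\<close>, but no root of a nonzero polynomial of degree below \<open>deg \<phi>\<close>.  Hence in the
  \<open>\<phi>\<close>-adic expansion of \<open>\<psi>\<close> the coefficients have no roots in \<open>B\<close>.  The degree of the
  reduction of a polynomial on \<open>B\<close> is its number of roots in \<open>B\<close>, so these degrees differ for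
  different terms of the expansion, and the number of roots of \<open>\<psi>\<close> in \<open>B\<close> is \<open>i\<close> times that
  of \<open>\<phi>\<close> for some \<open>i\<close>.  By conjugation, the roots of \<open>\<psi>\<close> and of \<open>\<phi>\<close> are each equally
  distributed over the conjugates of \<open>B\<close>, so \<open>deg \<psi> = i deg \<phi>\<close>.
\<close>

section \<open>Valuations and numbers of roots in balls\<close>

locale additive_valuation =
  fixes w :: "'b::field \<Rightarrow> 'h::linordered_ab_group_add extended"
  assumes valuation: "valuation w"
begin

lemma val_eq_Pinf_iff [simp]: "w x = Pinf \<longleftrightarrow> x = 0"
  and val_neq_Minf [simp]: "w x \<noteq> Minf"
  and val_mult: "w (x * y) = w x + w y"
  and val_add_min: "min (w x) (w y) \<le> w (x + y)"
  using valuation unfolding valuation_def by blast+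

lemma val_0 [simp]: "w 0 = Pinf"
  by simp

lemma val_less_Pinf_iff [simp]: "w x < Pinf \<longleftrightarrow> x \<noteq> 0"
  by (metis val_eq_Pinf_iff le_Pinf order_le_less order_less_irrefl)

lemma val_finite:
  assumes "x \<noteq> 0"
  obtains a where "w x = Fin a"
  using assms by (cases "w x") auto

lemma val_1: "w 1 = Fin 0"
proof -
  obtain a where a: "w 1 = Fin a"
    by (rule val_finite[of 1]) simp
  with val_mult[of 1 1] show ?thesis by simp
qed

lemma val_uminus [simp]: "w (- x) = w x"
proof -
  obtain a where a: "w (- 1) = Fin a"
    by (rule val_finite[of "- 1"]) simp
  with val_mult[of "- 1" "- 1"] have "a + a = 0"
    by (simp add: val_1)
  then have "a = 0"
    by simp
  with a val_mult[of "- 1" x] show ?thesis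
    by (simp flip: zero_extended_def)
qed

lemma val_minus_commute: "w (x - y) = w (y - x)"
  by (metis minus_diff_eq val_uminus)

lemma val_mult_left_strict_mono:
  assumes "c \<noteq> 0" "w x < w y"
  shows "w (c * x) < w (c * y)"
proof -
  have "x \<noteq> 0"
    using assms(2) by auto
  with assms show ?thesis
    by (auto simp: val_mult elim!: val_finite) (cases "w y"; auto)+
qed

lemma val_mult_mono: "w x \<le> w x' \<Longrightarrow> w y \<le> w y' \<Longrightarrow> w (x * y) \<le> w (x' * y')"
  by (simp add: val_mult add_mono)

lemma val_add_ge: "c \<le> w x \<Longrightarrow> c \<le> w y \<Longrightarrow> c \<le> w (x + y)"
  using val_add_min[of x y] by (meson min.bounded_iff order_trans)

lemma val_add_gt: "c < w x \<Longrightarrow> c < w y \<Longrightarrow> c < w (x + y)"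
  using val_add_min[of x y] by (metis min_less_iff_conj order_less_le_trans)

lemma val_add_eq_left:
  assumes "w x < w y"
  shows "w (x + y) = w x"
proof (rule antisym)
  show "w x \<le> w (x + y)"
    using assms by (intro val_add_ge) auto
  show "w (x + y) \<le> w x"
  proof (rule ccontr)
    assume "\<not> ?thesis"
    then show False
      using val_add_gt[of "w x" "x + y" "- y"] assms by (simp add: not_le)
  qed
qed

lemma val_diff_ge_trans:
  assumes "e \<le> w (x - y)" "e \<le> w (y - z)"
  shows "e \<le> w (x - z)"
  using val_add_ge[OF assms] by simp

lemma val_sum_ge:
  assumes "\<And>i. i \<in> A \<Longrightarrow> c \<le> w (f i)"
  shows "c \<le> w (sum f A)"
  using assms by (induction A rule: infinite_finite_induct) (auto intro: val_add_ge)

lemma val_sum_gt: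
  assumes "\<And>i. i \<in> A \<Longrightarrow> c < w (f i)" "c < Pinf"
  shows "c < w (sum f A)"
  using assms by (induction A rule: infinite_finite_induct) (auto intro: val_add_gt)

lemma val_prod_mset_mono:
  assumes "\<And>x. x \<in># A \<Longrightarrow> w (f x) \<le> w (g x)"
  shows "w (\<Prod>x\<in>#A. f x) \<le> w (\<Prod>x\<in>#A. g x)"
  using assms by (induction A) (auto intro: val_mult_mono)

lemma val_prod_mset_const:
  assumes "\<And>x. x \<in># A \<Longrightarrow> w (f x) = w c"
  shows "w (\<Prod>x\<in>#A. f x) = w (c ^ size A)"
  using assms by (induction A) (auto simp: val_mult)

lemma val_power_mono: "w x \<le> w y \<Longrightarrow> w (x ^ n) \<le> w (y ^ n)"
  by (induction n) (auto intro: val_mult_mono)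

lemma val_power_Fin: "w x = Fin a \<Longrightarrow> w (x ^ n) = Fin (nsmul n a)"
  by (induction n) (auto simp: val_mult val_1)

lemma val_power_strict_mono:
  assumes "w x < w y" "n > 0"
  shows "w (x ^ n) < w (y ^ n)"
proof (cases "y = 0")
  case True
  with assms show ?thesis by (auto simp: zero_power)
next
  case False
  then obtain b where b: "w y = Fin b"
    by (rule val_finite)
  from assms(1) obtain a where a: "w x = Fin a"
    by (cases "w x") auto
  from a b assms show ?thesis
    by (simp add: val_power_Fin nsmul_strict_mono)
qed

text \<open>
  If \<open>j\<close> is dominant in \<open>p (c + d t)\<close>, then \<open>j\<close> is the degree of the reduction of \<open>p\<close> on the
  closed ball of radius \<open>w d\<close> around \<open>c\<close>, which is the number of roots of \<open>p\<close> in that ball.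
\<close>

definition dominant :: "'b poly \<Rightarrow> nat \<Rightarrow> bool" where
  "dominant p j \<longleftrightarrow>
     (\<forall>i<j. w (Polynomial.coeff p j) \<le> w (Polynomial.coeff p i)) \<and>
     (\<forall>i>j. w (Polynomial.coeff p j) < w (Polynomial.coeff p i))"

lemma dominant_nonzero:
  assumes "dominant p j"
  shows "Polynomial.coeff p j \<noteq> 0"
  using assms unfolding dominant_def by (metis val_0 less_extended_simps(4) lessI)

lemma dominant_unique:
  assumes "dominant p j" "dominant p k"
  shows "j = k"
  using assms unfolding dominant_def by (metis linorder_neqE_nat linorder_not_less)

lemma dominant_const: "c \<noteq> 0 \<Longrightarrow> dominant [:c:] 0"
  by (auto simp: dominant_def coeff_pCons split: nat.splits)

lemma dominant_linear:
  assumes "d \<noteq> 0"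
  shows "dominant [:a, d:] (if w d \<le> w a then 1 else 0)"
  using assms by (auto simp: dominant_def coeff_pCons not_le split: nat.splits)

text \<open>As in Gauss's lemma: every pair of indices other than (j, k) with sum at least j + k
  exceeds \<open>j\<close> in the first or \<open>k\<close> in the second entry, and such products
  of coefficients have strictly larger value than the one at (j, k).\<close>

lemma dominant_mult:
  assumes p: "dominant p j" and q: "dominant q k"
  shows "dominant (p * q) (j + k)"
proof -
  let ?c = "Polynomial.coeff"
  have nz: "?c p j \<noteq> 0" "?c q k \<noteq> 0"
    using p q by (auto dest: dominant_nonzero)
  have le: "w (?c p j) \<le> w (?c p a)" "w (?c q k) \<le> w (?c q a)" for a
    using p q unfolding dominant_def by (metis linorder_cases order.refl less_imp_le)+
  have ge: "w (?c p j * ?c q k) \<le> w (?c p a * ?c q b)" for a b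
    by (intro val_mult_mono le)
  have gt: "w (?c p j * ?c q k) < w (?c p a * ?c q b)" if "a > j \<or> b > k" for a b
    using that
  proof
    assume "a > j"
    then have "w (?c q k * ?c p j) < w (?c q k * ?c p a)"
      using p nz unfolding dominant_def by (intro val_mult_left_strict_mono) auto
    also have "\<dots> \<le> w (?c q b * ?c p a)"
      by (intro val_mult_mono le order.refl)
    finally show ?thesis by (simp add: mult.commute)
  next
    assume "b > k"
    then have "w (?c p j * ?c q k) < w (?c p j * ?c q b)"
      using q nz unfolding dominant_def by (intro val_mult_left_strict_mono) auto
    also have "\<dots> \<le> w (?c p a * ?c q b)"
      by (intro val_mult_mono le order.refl)
    finally show ?thesis .
  qed
  have "?c (p * q) (j + k) = ?c p j * ?c q k + (\<Sum>i\<in>{..j+k} - {j}. ?c p i * ?c q (j + k - i))"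
    unfolding coeff_mult by (subst sum.remove[of _ j]) auto
  also have "w \<dots> = w (?c p j * ?c q k)"
  proof (intro val_add_eq_left val_sum_gt gt)
    fix i assume "i \<in> {..j+k} - {j}"
    then show "i > j \<or> j + k - i > k" by auto
  qed (use nz in auto)
  finally have eq: "w (?c (p * q) (j + k)) = w (?c p j * ?c q k)" .
  show ?thesis
    unfolding dominant_def eq
  proof (intro conjI allI impI)
    fix i assume "i < j + k"
    show "w (?c p j * ?c q k) \<le> w (?c (p * q) i)"
      unfolding coeff_mult by (intro val_sum_ge ge)
  next
    fix i assume i: "i > j + k"
    show "w (?c p j * ?c q k) < w (?c (p * q) i)"
      unfolding coeff_mult
    proof (intro val_sum_gt gt)
      fix l assume "l \<in> {..i}"
      show "l > j \<or> i - l > k" using i by auto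
    qed (use nz in auto)
  qed
qed

text \<open>The polynomial whose dominant coefficient has smaller value wins. On a tie the larger
  index wins, because there and beyond it the other polynomial has only coefficients of strictly
  larger value.\<close>

lemma dominant_add:
  assumes "dominant p j" "dominant q k" "j \<noteq> k"
  shows "dominant (p + q) j \<or> dominant (p + q) k"
proof -
  have *: "dominant (p + q) j \<or> dominant (p + q) k"
    if p: "dominant p j" and q: "dominant q k" and "j < k" for p q j k
  proof -
    let ?c = "Polynomial.coeff"
    have lep: "w (?c p j) \<le> w (?c p a)" and leq: "w (?c q k) \<le> w (?c q a)" for a
      using p q unfolding dominant_def by (metis linorder_cases order.refl less_imp_le)+
    have ltp: "w (?c p j) < w (?c p a)" if "a > j" for a
      using p that unfolding dominant_def by auto
    have ltq: "w (?c q k) < w (?c q a)" if "a > k" for a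
      using q that unfolding dominant_def by auto
    show ?thesis
    proof (cases "w (?c q k) \<le> w (?c p j)")
      case True
      have eq: "w (?c p k + ?c q k) = w (?c q k)"
        using True ltp[OF \<open>j < k\<close>]
        by (subst add.commute, intro val_add_eq_left) (rule order_le_less_trans)
      have "dominant (p + q) k"
        unfolding dominant_def coeff_add eq
      proof (intro conjI allI impI)
        fix i assume "i < k"
        show "w (?c q k) \<le> w (?c p i + ?c q i)"
          by (intro val_add_ge leq order_trans[OF True lep])
      next
        fix i assume "i > k"
        then show "w (?c q k) < w (?c p i + ?c q i)"
          using \<open>j < k\<close> by (intro val_add_gt ltq order_le_less_trans[OF True ltp]) auto
      qed
      then show ?thesis ..
    next
      case False
      then have lt: "w (?c p j) < w (?c q i)" for i
        using leq[of i] by (meson not_le order_less_le_trans)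
      have eq: "w (?c p j + ?c q j) = w (?c p j)"
        by (intro val_add_eq_left lt)
      have "dominant (p + q) j"
        unfolding dominant_def coeff_add eq
        by (intro conjI allI impI val_add_ge val_add_gt lep ltp lt less_imp_le[OF lt])
      then show ?thesis ..
    qed
  qed
  show ?thesis
    using *[of p j q k] *[of q k p j] assms by (auto simp: add.commute linorder_neq_iff)
qed

text \<open>A factor contributes 1 if its root lies in the closed unit ball, that is, if \<rho> lies
  in the ball around \<open>c\<close>, and 0 otherwise; dominant indices of products add up.\<close>

lemma dominant_prod_linear:
  assumes "d \<noteq> 0"
  shows "dominant (\<Prod>\<rho>\<in>#A. [:c - \<rho>, d:]) (size {#\<rho> \<in># A. w d \<le> w (\<rho> - c)#})"
proof (induction A)
  case empty
  show ?case
    using dominant_const[of 1] by (simp add: one_pCons)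
next
  case (add \<rho> A)
  show ?case
    using dominant_mult[OF dominant_linear[OF assms, of "c - \<rho>"] add]
    by (auto simp: val_minus_commute split: if_splits)
qed

lemma dominant_pcompose_linear:
  assumes "d \<noteq> 0" "l \<noteq> 0"
  shows "dominant (pcompose (smult l (\<Prod>\<rho>\<in>#A. [:- \<rho>, 1:])) [:c, d:])
           (size {#\<rho> \<in># A. w d \<le> w (\<rho> - c)#})"
proof -
  have "pcompose (\<Prod>\<rho>\<in>#A. [:- \<rho>, 1:]) [:c, d:] = (\<Prod>\<rho>\<in>#A. [:c - \<rho>, d:])"
  proof (induction A)
    case (add \<rho> A)
    have "pcompose [:- \<rho>, 1:] [:c, d:] = [:c - \<rho>, d:]"
      by (simp add: pcompose_pCons)
    with add show ?case
      by (simp add: pcompose_mult del: mult_pCons_left)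
  qed (simp add: pcompose_1)
  then have "pcompose (smult l (\<Prod>\<rho>\<in>#A. [:- \<rho>, 1:])) [:c, d:] = [:l:] * (\<Prod>\<rho>\<in>#A. [:c - \<rho>, d:])"
    by (simp add: pcompose_smult)
  with dominant_mult[OF dominant_const[OF assms(2)] dominant_prod_linear[OF assms(1), of c A]]
  show ?thesis by simp
qed

end

section \<open>Splitting into linear factors over an algebraically closed field\<close>

lemma proots_prod_linear [simp]: "proots (\<Prod>x\<in>#A. [:- x, 1:]) = (A :: 'b::idom multiset)"
proof (induction A)
  case (add x A)
  have "(\<Prod>x\<in>#A. [:- x, 1:]) \<noteq> 0"
    by (auto simp: prod_mset_zero_iff)
  with add show ?case
    by (simp add: proots_mult del: mult_pCons_left)
qed simp

lemma poly_prod_linear: "poly (\<Prod>x\<in>#A. [:- x, 1:]) z = (\<Prod>x\<in>#A. z - (x :: 'b::comm_ring_1))"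
  by (induction A) (simp_all del: mult_pCons_left)

lemma poly_factor_proots:
  fixes p :: "'b::alg_closed_field poly"
  shows "p = smult (Polynomial.lead_coeff p) (\<Prod>x\<in>#proots p. [:- x, 1:])"
    and "size (proots p) = Polynomial.degree p"
proof -
  have "p = smult (Polynomial.lead_coeff p) (\<Prod>x\<in>#proots p. [:- x, 1:]) \<and>
    size (proots p) = Polynomial.degree p"
  proof (cases "p = 0")
    case False
    from alg_closed_imp_factorization[OF this] obtain A where
      A: "size A = Polynomial.degree p" "p = smult (Polynomial.lead_coeff p) (\<Prod>x\<in>#A. [:- x, 1:])"
      by blast
    have "proots p = A"
      using False by (subst A(2)) (simp del: prod_mset.insert)
    with A show ?thesis by simp
  qed simp
  then show "p = smult (Polynomial.lead_coeff p) (\<Prod>x\<in>#proots p. [:- x, 1:])"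
    and "size (proots p) = Polynomial.degree p"
    by blast+
qed

section \<open>Endomorphisms of the algebraic closure\<close>

lemma map_poly_hom_add:
  assumes "f 0 = 0" "\<And>x y. f (x + y) = f x + f y"
  shows "map_poly f (p + q) = map_poly f p + map_poly f q"
  by (rule poly_eqI) (simp add: coeff_map_poly assms)

lemma map_poly_hom_mult:
  fixes f :: "'b::comm_semiring_0 \<Rightarrow> 'c::comm_semiring_0"
  assumes "f 0 = 0" "\<And>x y. f (x + y) = f x + f y" "\<And>x y. f (x * y) = f x * f y"
  shows "map_poly f (p * q) = map_poly f p * map_poly f q"
  by (induction p)
     (simp_all add: map_poly_pCons map_poly_hom_add map_poly_smult assms)

section \<open>Polynomials over the base field viewed over the closure; minimal polynomials\<close>

abbreviation lift_ac :: "'a::field poly \<Rightarrow> 'a alg_closure poly" where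
  "lift_ac \<equiv> map_poly to_ac"

lemma lift_ac_add: "lift_ac (p + q) = lift_ac p + lift_ac q"
  by (simp add: map_poly_hom_add)

lemma lift_ac_mult: "lift_ac (p * q) = lift_ac p * lift_ac q"
  by (simp add: map_poly_hom_mult)

lemma degree_lift_ac [simp]: "Polynomial.degree (lift_ac p) = Polynomial.degree p"
  by (simp add: degree_map_poly)

lemma coeff_lift_ac [simp]: "Polynomial.coeff (lift_ac p) n = to_ac (Polynomial.coeff p n)"
  by (simp add: coeff_map_poly)

lemma lift_ac_eq_0_iff [simp]: "lift_ac p = 0 \<longleftrightarrow> p = 0"
  by (simp add: map_poly_eq_0_iff)

lemma degree_pos_if_root:
  assumes "p \<noteq> 0" "poly (lift_ac p) x = 0"
  shows "Polynomial.degree p > 0"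
proof (rule ccontr)
  assume "\<not> ?thesis"
  then obtain c where "p = [:c:]"
    by (metis degree_eq_zeroE not_gr_zero)
  with assms show False
    by (simp add: map_poly_pCons)
qed

lemma root_exists:
  assumes "Factorial_Ring.irreducible (p :: 'a::field poly)"
  obtains x where "poly (lift_ac p) x = 0"
proof -
  have "Polynomial.degree (lift_ac p) > 0"
    using assms is_unit_iff_degree[of p] by (auto simp: Factorial_Ring.irreducible_def)
  then show ?thesis
    using alg_closed_imp_poly_has_root that by blast
qed

text \<open>A nonzero polynomial of least degree vanishing at \<open>x\<close>, made monic, works:
  remainders of division by it vanish at \<open>x\<close> too, so they are zero by
  minimality.\<close>

lemma min_poly_exists:
  fixes x :: "'a::field alg_closure"
  obtains g where "Polynomial.lead_coeff g = 1" "Factorial_Ring.irreducible g"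
    "poly (lift_ac g) x = 0" "\<And>p. poly (lift_ac p) x = 0 \<Longrightarrow> g dvd p"
proof -
  define P where "P = (\<lambda>p. p \<noteq> 0 \<and> poly (lift_ac p) x = 0)"
  obtain p0 where "P p0"
    using alg_closure_algebraic[of x] unfolding P_def by blast
  then obtain g0 where g0: "P g0" and min: "\<And>p. P p \<Longrightarrow> Polynomial.degree g0 \<le> Polynomial.degree p"
    using ex_has_least_nat[of P p0 Polynomial.degree] by blast
  define g where "g = smult (inverse (Polynomial.lead_coeff g0)) g0"
  have [simp]: "g0 \<noteq> 0"
    using g0 by (simp add: P_def)
  have deg: "Polynomial.degree g = Polynomial.degree g0"
    by (simp add: g_def)
  have root: "poly (lift_ac g) x = 0"
    using g0 by (simp add: g_def P_def map_poly_smult)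
  have nz: "g \<noteq> 0"
    by (simp add: g_def)
  have dvd: "g dvd p" if p: "poly (lift_ac p) x = 0" for p
  proof (rule ccontr)
    assume ndvd: "\<not> g dvd p"
    have "lift_ac p = lift_ac (p div g) * lift_ac g + lift_ac (p mod g)"
      by (simp flip: lift_ac_mult lift_ac_add)
    then have "poly (lift_ac (p mod g)) x = 0"
      using p root by simp
    moreover have "p mod g \<noteq> 0"
      using ndvd by (simp add: mod_eq_0_iff_dvd)
    ultimately have "Polynomial.degree g \<le> Polynomial.degree (p mod g)"
      unfolding deg by (intro min) (simp add: P_def)
    with degree_mod_less_degree[OF nz ndvd] show False by simp
  qed
  have "Factorial_Ring.irreducible g"
  proof (rule Factorial_Ring.irreducibleI)
    show "\<not> g dvd 1"
    proof
      assume "g dvd 1"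
      then obtain h where "1 = g * h" by blast
      then have "lift_ac 1 = lift_ac g * lift_ac h"
        by (metis lift_ac_mult)
      then have "poly (lift_ac 1) x = 0"
        using root by (simp del: map_poly_1')
      then show False by simp
    qed
    fix a b assume ab: "g = a * b"
    then have "poly (lift_ac a) x = 0 \<or> poly (lift_ac b) x = 0"
      using root by (simp add: lift_ac_mult)
    then have "g dvd a \<or> g dvd b"
      using dvd by blast
    then show "a dvd 1 \<or> b dvd 1"
      using nz unfolding ab by (auto simp: dvd_mult_cancel_left dvd_mult_cancel_right)
  qed (rule nz)
  moreover have "Polynomial.lead_coeff g = 1"
    by (simp add: g_def)
  ultimately show ?thesis
    using that root dvd by blast
qed

text \<open>\<open>f\<close> is a unit times the minimal polynomial of \<open>x\<close>, so it
  divides whatever the latter divides.\<close>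

lemma irreducible_dvd_if_common_root:
  fixes x :: "'a::field alg_closure"
  assumes "Factorial_Ring.irreducible f" "poly (lift_ac f) x = 0" "poly (lift_ac p) x = 0"
  shows "f dvd p"
proof -
  obtain g where g: "Factorial_Ring.irreducible g" "\<And>p. poly (lift_ac p) x = 0 \<Longrightarrow> g dvd p"
    using min_poly_exists[of x] by metis
  from g(2)[OF assms(2)] obtain h where h: "f = g * h" ..
  have "\<not> g dvd 1"
    using g(1) by (rule Factorial_Ring.irreducible_not_unit)
  with assms(1) h have "h dvd 1"
    using Factorial_Ring.irreducibleD by blast
  then have "f dvd g"
    unfolding h by simp
  with g(2)[OF assms(3)] show ?thesis
    by (rule dvd_trans[rotated])
qed

text \<open>
  Graph of a homomorphism over the base field from a subring of the algebraic closure to the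
  closure.  For a relation that is a subring of the product, being single-valued reduces
  to the last condition.
\<close>

definition hom_graph :: "('a::field alg_closure \<times> 'a alg_closure) set \<Rightarrow> bool" where
  "hom_graph R \<longleftrightarrow>
     (\<forall>a. (to_ac a, to_ac a) \<in> R) \<and>
     (\<forall>x y x' y'. (x, y) \<in> R \<longrightarrow> (x', y') \<in> R \<longrightarrow> (x + x', y + y') \<in> R) \<and>
     (\<forall>x y x' y'. (x, y) \<in> R \<longrightarrow> (x', y') \<in> R \<longrightarrow> (x * x', y * y') \<in> R) \<and>
     (\<forall>y. (0, y) \<in> R \<longrightarrow> y = 0)"

lemma
  assumes "hom_graph R"
  shows hom_graph_to_ac: "(to_ac a, to_ac a) \<in> R"
    and hom_graph_add: "(x, y) \<in> R \<Longrightarrow> (x', y') \<in> R \<Longrightarrow> (x + x', y + y') \<in> R"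
    and hom_graph_mult: "(x, y) \<in> R \<Longrightarrow> (x', y') \<in> R \<Longrightarrow> (x * x', y * y') \<in> R"
    and hom_graph_zero: "(0, y) \<in> R \<Longrightarrow> y = 0"
  using assms unfolding hom_graph_def by blast+

lemma hom_graph_0: "hom_graph R \<Longrightarrow> (0, 0) \<in> R"
  using hom_graph_to_ac[of R 0] by simp

lemma hom_graph_diff:
  assumes "hom_graph R" "(x, y) \<in> R" "(x', y') \<in> R"
  shows "(x - x', y - y') \<in> R"
  using hom_graph_add[OF assms(1,2) hom_graph_mult[OF assms(1) hom_graph_to_ac[OF assms(1), of "- 1"] assms(3)]]
  by simp

lemma hom_graph_sum:
  assumes "hom_graph R" "\<And>i. i \<in> A \<Longrightarrow> (f i, g i) \<in> R"
  shows "(sum f A, sum g A) \<in> R"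
  using assms(2)
  by (induction A rule: infinite_finite_induct)
     (auto intro: hom_graph_0 hom_graph_add assms(1))

lemma hom_graph_poly:
  assumes "hom_graph R" "(x, y) \<in> R"
  shows "(poly (lift_ac p) x, poly (lift_ac p) y) \<in> R"
  by (induction p)
     (auto simp: map_poly_pCons intro: assms hom_graph_0 hom_graph_add hom_graph_mult hom_graph_to_ac)

text \<open>Applying the minimal polynomial \<open>g\<close> of \<open>x\<close> to the pair
  \<open>(x, 0)\<close> shows that its constant coefficient is zero, which is impossible for
  irreducible \<open>g\<close> and nonzero \<open>x\<close>. This avoids inverses, as the domain of
  \<open>R\<close> is only known to be a ring.\<close>

lemma hom_graph_inj:
  assumes R: "hom_graph R" "(x, 0) \<in> R"
  shows "x = 0"
proof (rule ccontr)
  assume "x \<noteq> 0"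
  obtain g where g: "Factorial_Ring.irreducible g" "poly (lift_ac g) x = 0"
    using min_poly_exists[of x] by metis
  have "Polynomial.coeff g 0 \<noteq> 0"
  proof
    assume "Polynomial.coeff g 0 = 0"
    then obtain h where h: "g = pCons 0 h"
      by (metis coeff_pCons_0 pCons_cases)
    with g(2) \<open>x \<noteq> 0\<close> have "poly (lift_ac h) x = 0"
      by (simp add: map_poly_pCons)
    with g have "g dvd h"
      by (rule irreducible_dvd_if_common_root)
    then have "h = 0"
      using dvd_imp_degree_le[of g h] by (auto simp: h split: if_splits)
    with g(1) h show False by simp
  qed
  moreover have "(0, to_ac (Polynomial.coeff g 0)) \<in> R"
    using hom_graph_poly[OF R, of g] g(2) by (simp add: poly_0_coeff_0)
  then have "to_ac (Polynomial.coeff g 0) = 0"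
    by (rule hom_graph_zero[OF R(1)])
  ultimately show False by simp
qed

text \<open>For \<open>R\<close> the graph of \<open>\<sigma>\<close>, the graph of the extension of \<open>\<sigma>\<close> that sends \<open>x\<close> to \<open>y\<close>.\<close>

definition adjoin ::
  "('b::comm_ring_1 \<times> 'b) set \<Rightarrow> 'b \<Rightarrow> 'b \<Rightarrow> ('b \<times> 'b) set" where
  "adjoin R x y =
     {(poly p x, poly q y) | p q. \<forall>i. (Polynomial.coeff p i, Polynomial.coeff q i) \<in> R}"

text \<open>The assumption \<open>rel\<close> is what makes the new graph single-valued.\<close>

lemma hom_graph_adjoin:
  assumes R: "hom_graph R"
    and rel: "\<forall>p q. (\<forall>i. (Polynomial.coeff p i, Polynomial.coeff q i) \<in> R) \<longrightarrow>
      poly p x = 0 \<longrightarrow> poly q y = 0"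
  shows "hom_graph (adjoin R x y)" "R \<subseteq> adjoin R x y" "(x, y) \<in> adjoin R x y"
proof -
  have in_adjoin: "(poly p x, poly q y) \<in> adjoin R x y"
    if "\<And>i. (Polynomial.coeff p i, Polynomial.coeff q i) \<in> R" for p q
    using that unfolding adjoin_def by blast
  show sub: "R \<subseteq> adjoin R x y"
  proof clarify
    fix a b assume "(a, b) \<in> R"
    then have "(Polynomial.coeff [:a:] i, Polynomial.coeff [:b:] i) \<in> R" for i
      by (simp add: coeff_pCons hom_graph_0[OF R] split: nat.splits)
    from in_adjoin[OF this] show "(a, b) \<in> adjoin R x y"
      by simp
  qed
  have "(Polynomial.coeff [:0, 1:] i, Polynomial.coeff [:0, 1:] i) \<in> R" for i
    using hom_graph_0[OF R] hom_graph_to_ac[OF R, of 1]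
    by (simp add: coeff_pCons split: nat.splits)
  from in_adjoin[OF this] show "(x, y) \<in> adjoin R x y"
    by simp
  show "hom_graph (adjoin R x y)"
    unfolding hom_graph_def
  proof (intro conjI allI impI)
    fix a show "(to_ac a, to_ac a) \<in> adjoin R x y"
      using sub hom_graph_to_ac[OF R] by blast
  next
    fix a b a' b' assume "(a, b) \<in> adjoin R x y" "(a', b') \<in> adjoin R x y"
    then obtain p q p' q' where eq: "a = poly p x" "b = poly q y" "a' = poly p' x" "b' = poly q' y"
      and pq: "\<And>i. (Polynomial.coeff p i, Polynomial.coeff q i) \<in> R"
        "\<And>i. (Polynomial.coeff p' i, Polynomial.coeff q' i) \<in> R"
      unfolding adjoin_def by blast
    have "(poly (p + p') x, poly (q + q') y) \<in> adjoin R x y"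
      by (rule in_adjoin) (simp add: hom_graph_add[OF R] pq)
    then show "(a + a', b + b') \<in> adjoin R x y"
      by (simp add: eq)
    have "(poly (p * p') x, poly (q * q') y) \<in> adjoin R x y"
      by (rule in_adjoin) (auto simp: coeff_mult intro!: hom_graph_sum[OF R] hom_graph_mult[OF R] pq)
    then show "(a * a', b * b') \<in> adjoin R x y"
      by (simp add: eq)
  next
    fix b assume "(0, b) \<in> adjoin R x y"
    then show "b = 0"
      unfolding adjoin_def using rel by auto
  qed
qed

text \<open>\<open>p0\<close> has least degree among the nonzero polynomials over the domain of
  \<open>R\<close> that vanish at \<open>x\<close>, and \<open>y\<close> is a root of its image
  \<open>q0\<close>. Any other polynomial vanishing at \<open>x\<close> reduces to zero modulo
  \<open>p0\<close>, so its image vanishes at \<open>y\<close>.\<close>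

lemma hom_graph_extend:
  assumes R: "hom_graph R"
  shows "\<exists>R' y. hom_graph R' \<and> R \<subseteq> R' \<and> (x, y) \<in> R'"
proof -
  define P where "P = (\<lambda>p. p \<noteq> 0 \<and> poly p x = 0 \<and>
    (\<exists>q. \<forall>i. (Polynomial.coeff p i, Polynomial.coeff q i) \<in> R))"
  obtain f where "f \<noteq> 0" "poly (lift_ac f) x = 0"
    using alg_closure_algebraic[of x] by metis
  then have "P (lift_ac f)"
    unfolding P_def using hom_graph_to_ac[OF R] by (auto intro!: exI[of _ "lift_ac f"])
  then obtain p0 where p0: "P p0" and min: "\<And>p. P p \<Longrightarrow> Polynomial.degree p0 \<le> Polynomial.degree p"
    using ex_has_least_nat[of P "lift_ac f" Polynomial.degree] by blast
  from p0 obtain q0 where q0: "\<And>i. (Polynomial.coeff p0 i, Polynomial.coeff q0 i) \<in> R"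
    unfolding P_def by blast
  define n where "n = Polynomial.degree p0"
  have a: "Polynomial.coeff p0 n \<noteq> 0" and root: "poly p0 x = 0"
    using p0 by (auto simp: P_def n_def)
  \<comment> \<open>Injectivity keeps the leading coefficient nonzero, so that \<open>q0\<close> is
    not constant and has a root.\<close>
  have b: "Polynomial.coeff q0 n \<noteq> 0"
    using a q0[of n] hom_graph_inj[OF R] by auto
  have "n > 0"
  proof (rule ccontr)
    assume "\<not> n > 0"
    then obtain c where "p0 = [:c:]"
      by (metis n_def degree_eq_zeroE not_gr_zero)
    with root a show False
      by (simp add: n_def)
  qed
  with b have "Polynomial.degree q0 > 0"
    using le_degree[OF b] by simp
  then obtain y where y: "poly q0 y = 0"
    using alg_closed_imp_poly_has_root by blast
  \<comment> \<open>The bound \<open>k\<close> on the indices of nonzero coefficients of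
    \<open>p\<close> is the induction measure.\<close>
  have rel: "poly q y = 0"
    if "\<And>i. (Polynomial.coeff p i, Polynomial.coeff q i) \<in> R" "poly p x = 0"
      "\<And>i. i \<ge> k \<Longrightarrow> Polynomial.coeff p i = 0" for p q k
    using that
  proof (induction k arbitrary: p q)
    case 0
    then have "p = 0"
      by (intro poly_eqI) simp
    with 0(1) have "q = 0"
      by (intro poly_eqI) (simp add: hom_graph_zero[OF R])
    then show ?case by simp
  next
    case (Suc k)
    show ?case
    proof (cases "k < n")
      case True
      have "p = 0"
      proof (rule ccontr)
        assume "p \<noteq> 0"
        with Suc.prems have "P p"
          by (auto simp: P_def)
        then have "n \<le> Polynomial.degree p"
          unfolding n_def by (rule min)
        with True Suc.prems(3)[of "Polynomial.degree p"] \<open>p \<noteq> 0\<close> show False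
          by simp
      qed
      with Suc.prems(1) have "q = 0"
        by (intro poly_eqI) (simp add: hom_graph_zero[OF R])
      then show ?thesis by simp
    next
      case False
      \<comment> \<open>Pseudo-division by \<open>p0\<close>: multiplying by its leading coefficient
        allows cancelling the coefficient of index \<open>k\<close> without dividing in the domain
        of \<open>R\<close>. The image of \<open>p'\<close> is \<open>q'\<close>.\<close>
      define p' where "p' = smult (Polynomial.coeff p0 n) p
        - Polynomial.monom (Polynomial.coeff p k) (k - n) * p0"
      define q' where "q' = smult (Polynomial.coeff q0 n) q
        - Polynomial.monom (Polynomial.coeff q k) (k - n) * q0"
      have "poly q' y = 0"
      proof (rule Suc.IH)
        fix i show "(Polynomial.coeff p' i, Polynomial.coeff q' i) \<in> R"
          unfolding p'_def q'_def
          by (auto simp: coeff_monom_mult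
              intro!: hom_graph_diff[OF R] hom_graph_mult[OF R] Suc.prems q0 hom_graph_0[OF R])
      next
        show "poly p' x = 0"
          using Suc.prems(2) root by (simp add: p'_def)
      next
        fix i assume "i \<ge> k"
        show "Polynomial.coeff p' i = 0"
        proof (cases "i = k")
          case True
          with False show ?thesis
            by (simp add: p'_def coeff_monom_mult)
        next
          case neq: False
          with \<open>i \<ge> k\<close> have "Polynomial.coeff p i = 0"
            by (intro Suc.prems(3)) simp
          moreover have "Polynomial.coeff p0 (i - (k - n)) = 0"
            using neq \<open>i \<ge> k\<close> False by (intro coeff_eq_0) (simp flip: n_def)
          ultimately show ?thesis
            by (simp add: p'_def coeff_monom_mult)
        qed
      qed
      with y b show ?thesis
        by (simp add: q'_def)
    qed
  qed
  have "\<forall>p q. (\<forall>i. (Polynomial.coeff p i, Polynomial.coeff q i) \<in> R) \<longrightarrow>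
      poly p x = 0 \<longrightarrow> poly q y = 0"
  proof (intro allI impI)
    fix p q
    assume "\<forall>i. (Polynomial.coeff p i, Polynomial.coeff q i) \<in> R" "poly p x = 0"
    then show "poly q y = 0"
      by (intro rel[of p q "Suc (Polynomial.degree p)"]) (auto intro: coeff_eq_0)
  qed
  from hom_graph_adjoin[OF R this] show ?thesis
    by blast
qed

text \<open>Bijectivity is not demanded; by \<open>K_endo_proots\<close>, \<sigma> still permutes
  the roots of each nonzero polynomial over the base field.\<close>

definition K_endo :: "('a::field alg_closure \<Rightarrow> 'a alg_closure) \<Rightarrow> bool" where
  "K_endo \<sigma> \<longleftrightarrow> (\<forall>x y. \<sigma> (x + y) = \<sigma> x + \<sigma> y) \<and> (\<forall>x y. \<sigma> (x * y) = \<sigma> x * \<sigma> y) \<and>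
     (\<forall>a. \<sigma> (to_ac a) = to_ac a)"

text \<open>The identity of the base field extends by sending \<open>x\<close> to \<open>y\<close>,
  because \<open>f\<close> divides every polynomial over the base field that vanishes at
  \<open>x\<close>. Zorn's lemma gives a maximal graph containing this one, and
  \<open>hom_graph_extend\<close> makes it total.\<close>

lemma K_endo_exists:
  assumes f: "Factorial_Ring.irreducible f" "poly (lift_ac f) x = 0" "poly (lift_ac f) y = 0"
  obtains \<sigma> where "K_endo \<sigma>" "\<sigma> x = y"
proof -
  define R0 where "R0 = range (\<lambda>a::'a. (to_ac a, to_ac a))"
  have R0: "hom_graph R0"
    unfolding hom_graph_def R0_def
    by (auto simp flip: to_ac_add to_ac_mult)
  have "poly q y = 0"
    if "\<And>i. (Polynomial.coeff p i, Polynomial.coeff q i) \<in> R0" "poly p x = 0" for p q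
  proof -
    have "Polynomial.coeff p i = Polynomial.coeff q i" for i
      using that(1)[of i] by (auto simp: R0_def)
    then have "p = q"
      by (rule poly_eqI)
    \<comment> \<open>All coefficients of \<open>p\<close> come from the base field, so
      \<open>p\<close> can be pulled back with \<open>of_ac\<close> and divided by \<open>f\<close>
      there.\<close>
    have "Polynomial.coeff p i = to_ac (of_ac (Polynomial.coeff p i))" for i
      using that(1)[of i] by (auto simp: R0_def)
    then have p: "p = lift_ac (map_poly of_ac p)"
      by (intro poly_eqI) (simp add: coeff_map_poly)
    have "f dvd map_poly of_ac p"
      using f(1,2) that(2) by (subst (asm) p) (rule irreducible_dvd_if_common_root)
    then obtain h where "map_poly of_ac p = f * h" ..
    with f(3) have "poly (lift_ac (map_poly of_ac p)) y = 0"
      by (simp add: lift_ac_mult)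
    with p \<open>p = q\<close> show "poly q y = 0" by metis
  qed
  then have "\<forall>p q. (\<forall>i. (Polynomial.coeff p i, Polynomial.coeff q i) \<in> R0) \<longrightarrow>
      poly p x = 0 \<longrightarrow> poly q y = 0"
    by blast
  note R1 = hom_graph_adjoin[OF R0 this]
  define R1 where "R1 = adjoin R0 x y"
  define HG where "HG = {R. hom_graph R \<and> R1 \<subseteq> R}"
  have "\<exists>M\<in>HG. \<forall>N\<in>HG. M \<subseteq> N \<longrightarrow> N = M"
  proof (rule subset_Zorn_nonempty)
    show "HG \<noteq> {}"
      using R1(1) by (auto simp: HG_def R1_def)
    fix C assume chain: "C \<noteq> {}" "subset.chain HG C"
    have hom: "hom_graph R" "R1 \<subseteq> R" if "R \<in> C" for R
      using chain(2) that by (auto simp: subset_chain_def HG_def)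
    have two: "\<exists>R\<in>C. s \<in> R \<and> t \<in> R" if "s \<in> \<Union>C" "t \<in> \<Union>C" for s t
      using that chain(2) by (simp add: subset_chain_def) (meson subsetD)
    have "hom_graph (\<Union>C)"
      unfolding hom_graph_def
    proof (intro conjI allI impI)
      fix a show "(to_ac a, to_ac a) \<in> \<Union>C"
        using chain(1) hom hom_graph_to_ac by blast
    next
      fix a b a' b' assume "(a, b) \<in> \<Union>C" "(a', b') \<in> \<Union>C"
      then obtain R where "R \<in> C" "(a, b) \<in> R" "(a', b') \<in> R"
        using two by blast
      then show "(a + a', b + b') \<in> \<Union>C" "(a * a', b * b') \<in> \<Union>C"
        using hom hom_graph_add hom_graph_mult by blast+
    next
      fix b assume "(0, b) \<in> \<Union>C"
      then show "b = 0"
        using hom hom_graph_zero by blast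
    qed
    moreover have "R1 \<subseteq> \<Union>C"
      using chain(1) hom by blast
    ultimately show "\<Union>C \<in> HG"
      by (simp add: HG_def)
  qed
  then obtain M where M: "hom_graph M" "R1 \<subseteq> M"
    and max: "\<And>R. hom_graph R \<Longrightarrow> M \<subseteq> R \<Longrightarrow> R = M"
    unfolding HG_def by (metis (mono_tags, lifting) mem_Collect_eq order_trans)
  have total: "\<exists>b. (a, b) \<in> M" for a
    using hom_graph_extend[OF M(1), of a] max by blast
  have unique: "b = c" if "(a, b) \<in> M" "(a, c) \<in> M" for a b c
    using hom_graph_zero[OF M(1), of "b - c"] hom_graph_diff[OF M(1) that] by simp
  define \<sigma> where "\<sigma> a = (THE b. (a, b) \<in> M)" for a
  have \<sigma>: "\<sigma> a = b \<longleftrightarrow> (a, b) \<in> M" for a b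
    using total[of a] unique unfolding \<sigma>_def by (metis theI)
  have graph: "(a, \<sigma> a) \<in> M" for a
    using \<sigma> by blast
  have "K_endo \<sigma>"
    unfolding K_endo_def \<sigma>
    by (intro conjI allI hom_graph_add hom_graph_mult hom_graph_to_ac M(1) graph)
  moreover have "\<sigma> x = y"
    unfolding \<sigma> using R1(3) M(2) by (auto simp: R1_def)
  ultimately show ?thesis
    by (rule that)
qed

section \<open>Action of endomorphisms on values of polynomials and on roots\<close>

lemma K_endo_0 [simp]: "K_endo \<sigma> \<Longrightarrow> \<sigma> 0 = 0"
  unfolding K_endo_def by (metis to_ac_0)

lemma K_endo_1 [simp]: "K_endo \<sigma> \<Longrightarrow> \<sigma> 1 = 1"
  unfolding K_endo_def by (metis to_ac_1)

lemma K_endo_eq_0_iff [simp]: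
  assumes "K_endo \<sigma>"
  shows "\<sigma> x = 0 \<longleftrightarrow> x = 0"
proof
  assume "\<sigma> x = 0"
  show "x = 0"
  proof (rule ccontr)
    assume "x \<noteq> 0"
    then have "\<sigma> 1 = \<sigma> x * \<sigma> (inverse x)"
      using assms unfolding K_endo_def by (metis right_inverse)
    with assms \<open>\<sigma> x = 0\<close> show False by simp
  qed
qed (use assms in simp)

lemma K_endo_diff:
  assumes "K_endo \<sigma>"
  shows "\<sigma> (x - y) = \<sigma> x - \<sigma> y"
proof -
  have "\<sigma> (x - y) + \<sigma> y = \<sigma> x"
    using assms unfolding K_endo_def by (metis diff_add_cancel)
  then show ?thesis by (simp add: eq_diff_eq)
qed

lemma K_endo_poly:
  assumes "K_endo \<sigma>"
  shows "\<sigma> (poly (lift_ac p) x) = poly (lift_ac p) (\<sigma> x)"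
  using assms by (induction p) (simp_all add: map_poly_pCons K_endo_def)

text \<open>Applying \<sigma> to coefficients fixes \<open>lift_ac p\<close> and turns each linear
  factor into that of the image root. Comparing the two factorizations also takes care of
  multiplicities.\<close>

lemma K_endo_proots:
  assumes \<sigma>: "K_endo \<sigma>"
  shows "image_mset \<sigma> (proots (lift_ac p)) = proots (lift_ac p)"
proof (cases "p = 0")
  case False
  define A where "A = proots (lift_ac p)"
  define c where "c = to_ac (Polynomial.lead_coeff p)"
  have hom: "\<sigma> 0 = 0" "\<sigma> (x + y) = \<sigma> x + \<sigma> y" "\<sigma> (x * y) = \<sigma> x * \<sigma> y" "\<sigma> (- x) = - \<sigma> x" for x y
    using \<sigma> K_endo_diff[OF \<sigma>, of 0 x] by (simp_all add: K_endo_def)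
  have p: "lift_ac p = smult c (\<Prod>x\<in>#A. [:- x, 1:])"
    using poly_factor_proots(1)[of "lift_ac p"] by (simp add: A_def c_def)
  have "map_poly \<sigma> (\<Prod>x\<in>#A. [:- x, 1:]) = (\<Prod>x\<in>#image_mset \<sigma> A. [:- x, 1:])"
    by (induction A)
       (simp_all add: map_poly_hom_mult map_poly_pCons hom \<sigma> del: mult_pCons_left)
  moreover have "map_poly \<sigma> (lift_ac p) = lift_ac p"
    using \<sigma> by (intro poly_eqI) (simp add: coeff_map_poly K_endo_def)
  moreover have "\<sigma> c = c"
    using \<sigma> by (simp add: c_def K_endo_def)
  ultimately have "lift_ac p = smult c (\<Prod>x\<in>#image_mset \<sigma> A. [:- x, 1:])"
    using p by (metis hom(1,3) map_poly_smult)
  moreover have "c \<noteq> 0"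
    using False by (simp add: c_def)
  ultimately have "proots (lift_ac p) = image_mset \<sigma> A"
    by (metis proots_smult proots_prod_linear)
  then show ?thesis
    by (simp add: A_def)
qed simp

lemma sum_mset_const_cong:
  assumes "\<And>x. x \<in># A \<Longrightarrow> f x = c"
  shows "(\<Sum>x\<in>#A. f x) = size A * (c :: nat)"
  using assms by (induction A) auto

lemma size_filter_mset_conv_sum: "size (filter_mset P A) = (\<Sum>x\<in>#A. if P x then 1 else 0)"
  by (induction A) auto

section \<open>Polynomials over henselian fields\<close>

locale henselian_field =
  fixes v :: "'a::field \<Rightarrow> 'g::linordered_ab_group_add extended"
  assumes henselian: "henselian v"
begin

abbreviation w :: "'a alg_closure \<Rightarrow> 'g dhull extended" where
  "w \<equiv> val_ac v"

sublocale additive_valuation w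
  using extends_valuation_val_ac[OF henselian]
  by unfold_locales (simp add: extends_valuation_def)

text \<open>The composite of \<open>w\<close> with \<sigma> extends \<open>v\<close> as well. This
  is where uniqueness of the extension enters.\<close>

lemma val_K_endo:
  assumes \<sigma>: "K_endo \<sigma>"
  shows "w (\<sigma> x) = w x"
proof -
  have "extends_valuation (w \<circ> \<sigma>) v"
    unfolding extends_valuation_def valuation_def
  proof (intro conjI allI)
    fix x y
    show "min ((w \<circ> \<sigma>) x) ((w \<circ> \<sigma>) y) \<le> (w \<circ> \<sigma>) (x + y)"
      using \<sigma> val_add_min[of "\<sigma> x" "\<sigma> y"] by (simp add: K_endo_def)
    show "(w \<circ> \<sigma>) (x * y) = (w \<circ> \<sigma>) x + (w \<circ> \<sigma>) y"
      using \<sigma> by (simp add: K_endo_def val_mult)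
  next
    fix a show "(w \<circ> \<sigma>) (to_ac a) = map_extended to_dhull (v a)"
      using \<sigma> extends_valuation_val_ac[OF henselian]
      by (simp add: K_endo_def extends_valuation_def)
  qed (use \<sigma> in simp_all)
  then have "w \<circ> \<sigma> = w"
    using henselian extends_valuation_val_ac[OF henselian] unfolding henselian_def by blast
  then show ?thesis
    by (metis comp_apply)
qed

text \<open>Roots are counted with multiplicity. The radius is given by an element \<open>d\<close>
  instead of a value so that \<open>c + d t\<close> can be substituted.\<close>

definition roots_near :: "'a poly \<Rightarrow> 'a alg_closure \<Rightarrow> 'a alg_closure \<Rightarrow> nat" where
  "roots_near p c d = size {#\<rho> \<in># proots (lift_ac p). w d \<le> w (\<rho> - c)#}"

lemma dominant_roots_near:
  assumes "p \<noteq> 0" "d \<noteq> 0"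
  shows "dominant (pcompose (lift_ac p) [:c, d:]) (roots_near p c d)"
  using assms unfolding roots_near_def
  by (subst poly_factor_proots(1)[of "lift_ac p"]) (intro dominant_pcompose_linear; simp)

lemma roots_near_K_endo:
  assumes "K_endo \<sigma>"
  shows "roots_near p (\<sigma> c) d = roots_near p c d"
proof -
  have "roots_near p (\<sigma> c) d =
      size {#\<rho> \<in># image_mset \<sigma> (proots (lift_ac p)). w d \<le> w (\<rho> - \<sigma> c)#}"
    by (simp add: roots_near_def K_endo_proots[OF assms])
  also have "\<dots> = roots_near p c d"
    using val_K_endo[OF assms]
    by (simp add: roots_near_def filter_mset_image_mset flip: K_endo_diff[OF assms])
  finally show ?thesis .
qed

lemma roots_near_conjugate:
  assumes "Factorial_Ring.irreducible f" "poly (lift_ac f) x = 0" "poly (lift_ac f) y = 0"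
  shows "roots_near p x d = roots_near p y d"
  using K_endo_exists[OF assms] roots_near_K_endo by metis

text \<open>Every point of an ultrametric ball is a center of it.\<close>

lemma roots_near_cong:
  assumes "w d \<le> w (x - y)"
  shows "roots_near p x d = roots_near p y d"
proof -
  have "w d \<le> w (\<rho> - x) \<longleftrightarrow> w d \<le> w (\<rho> - y)" for \<rho>
    using assms val_diff_ge_trans[of "w d" \<rho> x y] val_diff_ge_trans[of "w d" \<rho> y x]
    by (auto simp: val_minus_commute[of x y])
  then show ?thesis
    by (simp add: roots_near_def)
qed

text \<open>
  Both sides count the pairs of a root of \<open>f\<close> and a root of \<open>g\<close> whose difference has value at
  least \<open>w d\<close>.
\<close>

lemma roots_near_double_count:
  assumes f: "Factorial_Ring.irreducible f" "poly (lift_ac f) x = 0"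
    and g: "Factorial_Ring.irreducible g" "poly (lift_ac g) y = 0"
  shows "Polynomial.degree f * roots_near g x d = Polynomial.degree g * roots_near f y d"
proof -
  let ?A = "proots (lift_ac f)" and ?B = "proots (lift_ac g)"
  have nz: "f \<noteq> 0" "g \<noteq> 0"
    using f(1) g(1) by auto
  have near: "roots_near p c d = (\<Sum>\<rho>\<in>#proots (lift_ac p). if w d \<le> w (\<rho> - c) then 1 else 0)" for p c
    by (simp add: roots_near_def size_filter_mset_conv_sum)
  have "Polynomial.degree f * roots_near g x d = (\<Sum>\<rho>\<in>#?A. roots_near g \<rho> d)"
    using nz roots_near_conjugate[OF f(1) _ f(2), of _ g d]
    by (subst sum_mset_const_cong[where c = "roots_near g x d"])
       (auto simp: poly_factor_proots(2))
  also have "\<dots> = (\<Sum>\<rho>\<in>#?A. \<Sum>\<tau>\<in>#?B. if w d \<le> w (\<tau> - \<rho>) then 1 else 0)"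
    by (simp add: near)
  also have "\<dots> = (\<Sum>\<tau>\<in>#?B. \<Sum>\<rho>\<in>#?A. if w d \<le> w (\<rho> - \<tau>) then 1 else 0)"
    by (subst sum_mset.swap) (simp add: val_minus_commute)
  also have "\<dots> = (\<Sum>\<tau>\<in>#?B. roots_near f \<tau> d)"
    by (simp add: near)
  also have "\<dots> = Polynomial.degree g * roots_near f y d"
    using nz roots_near_conjugate[OF g(1) _ g(2), of _ f d]
    by (subst sum_mset_const_cong[where c = "roots_near f y d"])
       (auto simp: poly_factor_proots(2))
  finally show ?thesis .
qed

text \<open>
  In the expansion \<open>p = \<Sum> a\<^sub>i \<phi>\<^sup>i\<close> the coefficients have no roots near \<open>x\<close>, so the terms have
  pairwise distinct dominant indices, all divisible by the one of \<open>\<phi>\<close>.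
\<close>

lemma roots_near_dvd:
  assumes \<phi>: "\<phi> \<noteq> 0" "poly (lift_ac \<phi>) x = 0" and d: "d \<noteq> 0"
    and far: "\<And>a y. a \<noteq> 0 \<Longrightarrow> Polynomial.degree a < Polynomial.degree \<phi> \<Longrightarrow>
      poly (lift_ac a) y = 0 \<Longrightarrow> \<not> w d \<le> w (y - x)"
    and p: "p \<noteq> 0"
  shows "roots_near \<phi> x d dvd roots_near p x d"
  using p
proof (induction "Polynomial.degree p" arbitrary: p rule: less_induct)
  case less
  \<comment> \<open>The expansion is unwound one division at a time, with the induction hypothesis
    applied to the quotient.\<close>
  define q a where "q = p div \<phi>" and "a = p mod \<phi>"
  define D where "D p = pcompose (lift_ac p) [:x, d:]" for p
  define s where "s = roots_near \<phi> x d"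
  have dom: "dominant (D p) (roots_near p x d)" if "p \<noteq> 0" for p
    unfolding D_def using that d by (rule dominant_roots_near)
  have "x \<in># {#\<rho> \<in># proots (lift_ac \<phi>). w d \<le> w (\<rho> - x)#}"
    using \<phi> by simp
  then have "s > 0"
    unfolding s_def roots_near_def using nonempty_has_size by fastforce
  \<comment> \<open>By \<open>far\<close>, a nonzero remainder has no root in the ball, so its
    dominant index is 0.\<close>
  have near_a: "roots_near a x d = 0" if "a \<noteq> 0"
  proof -
    have "\<not> \<phi> dvd p"
      using that by (simp add: a_def mod_eq_0_iff_dvd)
    then have "Polynomial.degree a < Polynomial.degree \<phi>"
      unfolding a_def using \<phi>(1) by (intro degree_mod_less_degree)
    then have "{#\<rho> \<in># proots (lift_ac a). w d \<le> w (\<rho> - x)#} = {#}"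
      using far[OF that] that by (auto)
    then show ?thesis
      by (simp add: roots_near_def)
  qed
  have p: "p = \<phi> * q + a"
    by (simp add: q_def a_def)
  then have Dp: "D p = D \<phi> * D q + D a"
    by (simp add: D_def lift_ac_add lift_ac_mult pcompose_add pcompose_mult)
  show ?case
  proof (cases "q = 0")
    case True
    with p less.prems near_a show ?thesis by simp
  next
    case False
    have "Polynomial.degree \<phi> > 0"
      using \<phi> by (rule degree_pos_if_root)
    then have "Polynomial.degree a < Polynomial.degree (\<phi> * q)"
      using False \<phi>(1) degree_mod_less[of \<phi> p] by (auto simp: a_def degree_mult_eq)
    with False \<phi>(1) \<open>Polynomial.degree \<phi> > 0\<close>
    have "Polynomial.degree q < Polynomial.degree p"
      by (subst p) (simp add: degree_add_eq_left degree_mult_eq)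
    then have "s dvd roots_near q x d"
      unfolding s_def using False by (rule less.hyps)
    then have dvd: "s dvd s + roots_near q x d"
      by simp
    have dom': "dominant (D \<phi> * D q) (s + roots_near q x d)"
      unfolding s_def using dom \<phi>(1) False by (intro dominant_mult)
    show ?thesis
    proof (cases "a = 0")
      case True
      then have "dominant (D p) (s + roots_near q x d)"
        using dom' Dp by (simp add: D_def)
      with dom[OF less.prems] dvd dominant_unique show ?thesis
        unfolding s_def by metis
    next
      case False
      \<comment> \<open>The two indices differ because \<open>s > 0\<close>, and both are multiples
        of \<open>s\<close>.\<close>
      have "dominant (D p) (s + roots_near q x d) \<or> dominant (D p) 0"
        unfolding Dp using dom' dom[OF False] near_a[OF False] \<open>s > 0\<close>
        by (intro dominant_add) auto
      with dom[OF less.prems] dvd dominant_unique show ?thesis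
        unfolding s_def by (metis dvd_0_right)
    qed
  qed
qed

text \<open>The balls around \<open>x\<close> and \<open>y\<close> coincide, so double counting
  turns the divisibility between the numbers of roots in this ball into one between degrees; the
  common factor \<open>s\<close> cancels as \<open>x\<close> itself is counted.\<close>

theorem degree_dvd_degree:
  assumes \<phi>: "Factorial_Ring.irreducible \<phi>" "poly (lift_ac \<phi>) x = 0" and d: "d \<noteq> 0"
    and far: "\<And>a y. a \<noteq> 0 \<Longrightarrow> Polynomial.degree a < Polynomial.degree \<phi> \<Longrightarrow>
      poly (lift_ac a) y = 0 \<Longrightarrow> \<not> w d \<le> w (y - x)"
    and f: "Factorial_Ring.irreducible f" "poly (lift_ac f) y = 0" and near: "w d \<le> w (y - x)"
  shows "Polynomial.degree \<phi> dvd Polynomial.degree f"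
proof -
  have nz: "\<phi> \<noteq> 0" "f \<noteq> 0"
    using \<phi>(1) f(1) by auto
  define s where "s = roots_near \<phi> x d"
  have "x \<in># {#\<rho> \<in># proots (lift_ac \<phi>). w d \<le> w (\<rho> - x)#}"
    using \<phi> nz by simp
  then have "s > 0"
    unfolding s_def roots_near_def using nonempty_has_size by fastforce
  have "s dvd roots_near f x d"
    unfolding s_def using nz(1) \<phi>(2) d far nz(2) by (rule roots_near_dvd)
  then obtain i where i: "roots_near f x d = s * i" ..
  have "Polynomial.degree f * s = Polynomial.degree \<phi> * (s * i)"
    using roots_near_double_count[OF f \<phi>, of d] roots_near_cong[OF near]
    by (simp add: i s_def)
  with \<open>s > 0\<close> have "Polynomial.degree f = Polynomial.degree \<phi> * i"
    by (simp add: ac_simps)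
  then show ?thesis ..
qed

text \<open>Both sides are the value of the resultant of \<open>f\<close> and \<open>g\<close>.\<close>

lemma val_poly_reciprocity:
  assumes f: "Polynomial.lead_coeff f = 1" "Factorial_Ring.irreducible f" "poly (lift_ac f) x = 0"
    and g: "Polynomial.lead_coeff g = 1" "Factorial_Ring.irreducible g" "poly (lift_ac g) y = 0"
  shows "w (poly (lift_ac g) x ^ Polynomial.degree f) = w (poly (lift_ac f) y ^ Polynomial.degree g)"
proof -
  let ?A = "proots (lift_ac f)" and ?B = "proots (lift_ac g)"
  have nz: "f \<noteq> 0" "g \<noteq> 0"
    using f(2) g(2) by auto
  \<comment> \<open>Values at conjugate points agree, so each power below can be replaced by a
    product over all roots.\<close>
  have conj: "w (poly (lift_ac p) z) = w (poly (lift_ac p) z')"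
    if q: "Factorial_Ring.irreducible q" "poly (lift_ac q) z = 0" "poly (lift_ac q) z' = 0" for p q z z'
  proof -
    obtain \<sigma> where "K_endo \<sigma>" "\<sigma> z' = z"
      by (rule K_endo_exists[OF q(1,3,2)])
    then show ?thesis
      using val_K_endo[of \<sigma> "poly (lift_ac p) z'"] by (simp add: K_endo_poly)
  qed
  have eval: "poly (lift_ac p) z = (\<Prod>\<tau>\<in>#proots (lift_ac p). z - \<tau>)"
    if "Polynomial.lead_coeff p = 1" for p z
  proof -
    have "lift_ac p = (\<Prod>\<tau>\<in>#proots (lift_ac p). [:- \<tau>, 1:])"
      using poly_factor_proots(1)[of "lift_ac p"] that by simp
    then show ?thesis
      using poly_prod_linear[of "proots (lift_ac p)" z] by simp
  qed
  have "w (poly (lift_ac g) x ^ Polynomial.degree f) = w (\<Prod>\<rho>\<in>#?A. poly (lift_ac g) \<rho>)"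
    using nz val_prod_mset_const[of ?A "poly (lift_ac g)" "poly (lift_ac g) x"] conj[OF f(2) _ f(3)]
    by (simp add: poly_factor_proots(2))
  also have "\<dots> = w (\<Prod>\<tau>\<in>#?B. \<Prod>\<rho>\<in>#?A. \<rho> - \<tau>)"
    unfolding eval[OF g(1)] by (subst prod_mset.swap) simp
  also have "\<dots> = w (\<Prod>\<tau>\<in>#?B. \<Prod>\<rho>\<in>#?A. \<tau> - \<rho>)"
    by (intro antisym val_prod_mset_mono) (simp_all add: val_minus_commute)
  also have "\<dots> = w (\<Prod>\<tau>\<in>#?B. poly (lift_ac f) \<tau>)"
    by (simp add: eval[OF f(1)])
  also have "\<dots> = w (poly (lift_ac f) y ^ Polynomial.degree g)"
    using nz val_prod_mset_const[of ?B "poly (lift_ac f)" "poly (lift_ac f) y"] conj[OF g(2) _ g(3)]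
    by (simp add: poly_factor_proots(2))
  finally show ?thesis .
qed

text \<open>The comparison holds factor by factor. Moving a root \<tau> of \<open>F\<close> to
  \<theta> by conjugation sends \<open>x\<close> to a root of \<phi>, so
  \<open>w (x - \<tau>) \<le> w (\<theta> - x)\<close>. Hence \<open>\<theta> - \<tau>\<close> and
  \<open>y - \<theta>\<close> have value at least \<open>w (x - \<tau>)\<close>, and so has their
  sum.\<close>

lemma val_poly_mono:
  assumes F: "Polynomial.lead_coeff F = 1" "Factorial_Ring.irreducible F" "poly (lift_ac F) \<theta> = 0"
    and max: "\<And>\<rho>. poly (lift_ac \<phi>) \<rho> = 0 \<Longrightarrow> w (\<theta> - \<rho>) \<le> w (\<theta> - x)"
    and x: "poly (lift_ac \<phi>) x = 0" and y: "w (\<theta> - x) \<le> w (\<theta> - y)"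
  shows "w (poly (lift_ac F) x) \<le> w (poly (lift_ac F) y)"
proof -
  let ?A = "proots (lift_ac F)"
  have F0: "F \<noteq> 0"
    using F(2) by auto
  have "lift_ac F = (\<Prod>\<tau>\<in>#?A. [:- \<tau>, 1:])"
    using poly_factor_proots(1)[of "lift_ac F"] F(1) by simp
  then have eval: "poly (lift_ac F) z = (\<Prod>\<tau>\<in>#?A. z - \<tau>)" for z
    using poly_prod_linear[of ?A z] by simp
  show ?thesis
    unfolding eval
  proof (rule val_prod_mset_mono)
    fix \<tau> assume "\<tau> \<in># ?A"
    with F0 have "poly (lift_ac F) \<tau> = 0"
      by simp
    then obtain \<sigma> where \<sigma>: "K_endo \<sigma>" "\<sigma> \<tau> = \<theta>"
      by (rule K_endo_exists[OF F(2) _ F(3)])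
    have "poly (lift_ac \<phi>) (\<sigma> x) = 0"
      using K_endo_poly[OF \<sigma>(1), of \<phi> x] x \<sigma>(1) by simp
    then have "w (\<theta> - \<sigma> x) \<le> w (\<theta> - x)"
      by (rule max)
    moreover have "w (x - \<tau>) = w (\<theta> - \<sigma> x)"
      using val_K_endo[OF \<sigma>(1), of "\<tau> - x"] \<sigma> by (simp add: K_endo_diff val_minus_commute)
    ultimately have e: "w (x - \<tau>) \<le> w (\<theta> - x)"
      by simp
    then have "w (x - \<tau>) \<le> w (\<theta> - \<tau>)"
      by (rule val_diff_ge_trans) simp
    moreover have "w (x - \<tau>) \<le> w (y - \<theta>)"
      using e y by (simp add: val_minus_commute[of y])
    ultimately show "w (x - \<tau>) \<le> w (y - \<tau>)"
      by (intro val_diff_ge_trans[of _ y \<theta> \<tau>])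
  qed
qed

section \<open>Weights\<close>

lemma closest_root:
  assumes "Factorial_Ring.irreducible p"
  obtains x where "poly (lift_ac p) x = 0"
    "\<And>\<rho>. poly (lift_ac p) \<rho> = 0 \<Longrightarrow> w (\<theta> - \<rho>) \<le> w (\<theta> - x)"
proof -
  define Z where "Z = {x. poly (lift_ac p) x = 0}"
  have "p \<noteq> 0"
    using assms by auto
  then have fin: "finite Z"
    unfolding Z_def by (intro poly_roots_finite) simp
  have "Z \<noteq> {}"
    using root_exists[OF assms] unfolding Z_def by blast
  with fin have "Max ((\<lambda>x. w (\<theta> - x)) ` Z) \<in> (\<lambda>x. w (\<theta> - x)) ` Z"
    by (intro Max_in) auto
  then obtain x where x: "x \<in> Z" "Max ((\<lambda>x. w (\<theta> - x)) ` Z) = w (\<theta> - x)"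
    by blast
  have "w (\<theta> - \<rho>) \<le> w (\<theta> - x)" if "\<rho> \<in> Z" for \<rho>
    unfolding x(2)[symmetric] using fin that by (intro Max_ge) auto
  with x(1) that show ?thesis
    by (simp add: Z_def)
qed

text \<open>The root chosen in \<open>val_poly\<close>, hence the one to which all weights
  refer.\<close>

definition frame_root :: "'a poly \<Rightarrow> 'a alg_closure" where
  "frame_root F = (SOME \<theta>. poly (lift_ac F) \<theta> = 0)"

lemma wt_eq:
  "wt v F g = map_extended (\<lambda>x. dhull_div x (Polynomial.degree g)) (w (poly (lift_ac g) (frame_root F)))"
  by (simp add: wt_def val_poly_def frame_root_def)

lemma frame_root:
  assumes "Factorial_Ring.irreducible F"
  shows "poly (lift_ac F) (frame_root F) = 0"
proof -
  obtain x where "poly (lift_ac F) x = 0"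
    by (rule root_exists[OF assms])
  then show ?thesis
    unfolding frame_root_def by (rule someI)
qed

text \<open>Clears the denominators of the weights, so that the comparison becomes one between
  values of powers.\<close>

lemma wt_less_imp:
  assumes less: "wt v F g < wt v F \<phi>"
    and pos: "Polynomial.degree g > 0" "Polynomial.degree \<phi> > 0"
  shows "w (poly (lift_ac g) (frame_root F) ^ Polynomial.degree \<phi>) <
    w (poly (lift_ac \<phi>) (frame_root F) ^ Polynomial.degree g)"
proof -
  define s t where "s = poly (lift_ac g) (frame_root F)" and "t = poly (lift_ac \<phi>) (frame_root F)"
  define d e where "d = Polynomial.degree g" and "e = Polynomial.degree \<phi>"
  have less': "map_extended (\<lambda>x. dhull_div x d) (w s) < map_extended (\<lambda>x. dhull_div x e) (w t)"
    using less by (simp add: wt_eq s_def t_def d_def e_def)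
  have de: "d > 0" "e > 0"
    using pos by (simp_all add: d_def e_def)
  obtain a where a: "w s = Fin a"
    using less' by (cases "w s") auto
  have "w (s ^ e) < w (t ^ d)"
  proof (cases "w t")
    case (Fin b)
    with less' a have "nsmul (e * d) (dhull_div a d) < nsmul (e * d) (dhull_div b e)"
      using de by (intro nsmul_strict_mono) auto
    moreover have "nsmul (e * d) (dhull_div a d) = nsmul e a"
      using de by (simp add: nsmul_dhull_div flip: nsmul_nsmul)
    moreover have "nsmul (e * d) (dhull_div b e) = nsmul d b"
      using de by (simp add: nsmul_dhull_div mult.commute[of e] flip: nsmul_nsmul)
    ultimately show ?thesis
      using a Fin by (simp add: val_power_Fin)
  next
    \<comment> \<open>Here \<open>t = 0\<close>, and the exponent \<open>d\<close> is positive, so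
      the right-hand value is infinite.\<close>
    case Pinf
    then show ?thesis
      using a de by (auto simp: zero_power)
  qed simp
  then show ?thesis
    by (simp add: s_def t_def d_def e_def)
qed

text \<open>
  By reciprocity the weight of \<open>\<phi>\<close> is \<open>w (F(x)) / deg F\<close> for any root \<open>x\<close> of \<open>\<phi>\<close>, and likewise
  for \<open>g\<close>; the comparison is carried out on powers to avoid dividing values.
\<close>

lemma wt_mono:
  assumes F: "Polynomial.lead_coeff F = 1" "Factorial_Ring.irreducible F"
    and \<phi>: "Polynomial.lead_coeff \<phi> = 1" "Factorial_Ring.irreducible \<phi>" "poly (lift_ac \<phi>) x = 0"
    and max: "\<And>\<rho>. poly (lift_ac \<phi>) \<rho> = 0 \<Longrightarrow> w (frame_root F - \<rho>) \<le> w (frame_root F - x)"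
    and g: "Polynomial.lead_coeff g = 1" "Factorial_Ring.irreducible g" "poly (lift_ac g) y = 0"
    and near: "w (frame_root F - x) \<le> w (frame_root F - y)"
  shows "wt v F \<phi> \<le> wt v F g"
proof (rule ccontr)
  define \<theta> where "\<theta> = frame_root F"
  define d e n where "d = Polynomial.degree g" and "e = Polynomial.degree \<phi>" and "n = Polynomial.degree F"
  have \<theta>: "poly (lift_ac F) \<theta> = 0"
    unfolding \<theta>_def using F(2) by (rule frame_root)
  have nz: "F \<noteq> 0" "\<phi> \<noteq> 0" "g \<noteq> 0"
    using F(2) \<phi>(2) g(2) by auto
  then have pos: "d > 0" "e > 0" "n > 0"
    unfolding d_def e_def n_def using degree_pos_if_root \<phi>(3) g(3) \<theta> by blast+
  have power_swap: "(a ^ i) ^ j = (a ^ j) ^ i" for a :: "'a alg_closure" and i j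
    by (metis power_mult mult.commute)
  assume "\<not> ?thesis"
  then have "w (poly (lift_ac g) \<theta> ^ e) < w (poly (lift_ac \<phi>) \<theta> ^ d)"
    using pos unfolding \<theta>_def d_def e_def by (intro wt_less_imp) auto
  \<comment> \<open>The additional exponent \<open>n\<close> makes reciprocity with \<open>F\<close>
    applicable on both sides.\<close>
  then have "w ((poly (lift_ac g) \<theta> ^ e) ^ n) < w ((poly (lift_ac \<phi>) \<theta> ^ d) ^ n)"
    using pos(3) by (rule val_power_strict_mono)
  then have less: "w ((poly (lift_ac g) \<theta> ^ n) ^ e) < w ((poly (lift_ac \<phi>) \<theta> ^ n) ^ d)"
    by (simp only: power_swap[of _ n])
  have power_cong: "w (a ^ k) = w (b ^ k)" if "w a = w b" for a b k
    using that by (intro antisym val_power_mono) auto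
  have "w ((poly (lift_ac \<phi>) \<theta> ^ n) ^ d) = w ((poly (lift_ac F) x ^ e) ^ d)"
    unfolding n_def e_def by (intro power_cong val_poly_reciprocity F \<phi> \<theta>)
  also have "\<dots> \<le> w ((poly (lift_ac F) y ^ e) ^ d)"
    using max near \<phi>(3) unfolding \<theta>_def
    by (intro val_power_mono val_poly_mono[OF F \<theta>[unfolded \<theta>_def]])
  also have "\<dots> = w ((poly (lift_ac F) y ^ d) ^ e)"
    by (simp only: power_swap[of _ e])
  also have "\<dots> = w ((poly (lift_ac g) \<theta> ^ n) ^ e)"
    unfolding n_def d_def by (intro power_cong val_poly_reciprocity[symmetric] F g \<theta>)
  finally show False
    using less by simp
qed

text \<open>\<open>degree_dvd_degree\<close> is applied to the ball around \<open>x\<close> of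
  radius \<open>w (\<theta> - x)\<close>. Growth of weights from level \<open>l\<close> to
  \<open>l + 1\<close> puts \<open>y\<close> into this ball; growth from level \<open>l - 1\<close>
  to \<open>l\<close> keeps out all roots of nonzero polynomials of degree below
  \<open>m l\<close>.\<close>

lemma okutsu_frame_step:
  assumes F: "Polynomial.lead_coeff F = 1" "Factorial_Ring.irreducible F"
    and frame: "okutsu_frame v F r \<Phi> m" and l: "l \<le> r"
  shows "m l dvd m (l + 1)"
proof -
  define \<theta> where "\<theta> = frame_root F"
  have \<Phi>: "\<Phi> ! k \<noteq> {}" "\<And>p. p \<in> \<Phi> ! k \<Longrightarrow>
      Polynomial.lead_coeff p = 1 \<and> Factorial_Ring.irreducible p \<and> Polynomial.degree p = m k"
    if "k \<le> r + 1" for k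
    using frame that unfolding okutsu_frame_def by blast+
  have best: "\<exists>p\<in>\<Phi> ! k. wt v F g \<le> wt v F p"
    if "k \<le> r" "Polynomial.lead_coeff g = 1" "0 < Polynomial.degree g" "Polynomial.degree g < m (k + 1)"
    for k g
    using frame that unfolding okutsu_frame_def by blast
  have incr: "wt v F p < wt v F q" if "k \<le> r" "p \<in> \<Phi> ! k" "q \<in> \<Phi> ! (k + 1)" for k p q
    using frame that unfolding okutsu_frame_def by blast
  obtain \<phi> \<psi> where in\<Phi>: "\<phi> \<in> \<Phi> ! l" "\<psi> \<in> \<Phi> ! (l + 1)"
    using \<Phi>(1)[of l] \<Phi>(1)[of "l + 1"] l by auto
  have \<phi>: "Polynomial.lead_coeff \<phi> = 1" "Factorial_Ring.irreducible \<phi>" "Polynomial.degree \<phi> = m l"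
    using \<Phi>(2)[OF _ in\<Phi>(1)] l by auto
  have \<psi>: "Polynomial.lead_coeff \<psi> = 1" "Factorial_Ring.irreducible \<psi>" "Polynomial.degree \<psi> = m (l + 1)"
    using \<Phi>(2)[OF _ in\<Phi>(2)] l by auto
  have less: "wt v F \<phi> < wt v F \<psi>"
    using l in\<Phi> by (rule incr)
  obtain x where x: "poly (lift_ac \<phi>) x = 0"
    and x_max: "\<And>\<rho>. poly (lift_ac \<phi>) \<rho> = 0 \<Longrightarrow> w (\<theta> - \<rho>) \<le> w (\<theta> - x)"
    using closest_root[OF \<phi>(2)] by metis
  obtain y where y: "poly (lift_ac \<psi>) y = 0"
    and y_max: "\<And>\<rho>. poly (lift_ac \<psi>) \<rho> = 0 \<Longrightarrow> w (\<theta> - \<rho>) \<le> w (\<theta> - y)"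
    using closest_root[OF \<psi>(2)] by metis
  \<comment> \<open>Otherwise \<open>wt_mono\<close> with the two polynomials exchanged contradicts
    (OF3).\<close>
  have y_near: "w (\<theta> - x) \<le> w (\<theta> - y)"
  proof (rule ccontr)
    assume "\<not> ?thesis"
    then have "wt v F \<psi> \<le> wt v F \<phi>"
      using F \<psi>(1,2) y y_max \<phi>(1,2) x unfolding \<theta>_def by (intro wt_mono[of F \<psi> y \<phi> x]) auto
    with less show False by simp
  qed
  \<comment> \<open>If \<theta> were equal to \<open>x\<close>, then \<phi> would have infinite
    weight, which (OF3) excludes.\<close>
  have d: "\<theta> - x \<noteq> 0"
  proof
    assume "\<theta> - x = 0"
    with x have "wt v F \<phi> = Pinf"
      by (simp add: wt_eq \<theta>_def)
    with less show False by simp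
  qed
  have "Polynomial.degree \<phi> dvd Polynomial.degree \<psi>"
  proof (rule degree_dvd_degree[OF \<phi>(2) x d _ \<psi>(2) y])
    have "w (\<theta> - x) \<le> w (y - \<theta>)"
      using y_near by (simp add: val_minus_commute)
    then show "w (\<theta> - x) \<le> w (y - x)"
      by (rule val_diff_ge_trans) simp
  next
    fix a :: "'a poly" and z
    assume a: "a \<noteq> 0" "Polynomial.degree a < Polynomial.degree \<phi>" "poly (lift_ac a) z = 0"
    show "\<not> w (\<theta> - x) \<le> w (z - x)"
    proof
      assume "w (\<theta> - x) \<le> w (z - x)"
      then have near: "w (\<theta> - x) \<le> w (\<theta> - z)"
        using val_diff_ge_trans[of "w (\<theta> - x)" \<theta> x z] by (simp add: val_minus_commute)
      obtain g where g: "Polynomial.lead_coeff g = 1" "Factorial_Ring.irreducible g"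
        "poly (lift_ac g) z = 0" "g dvd a"
        using min_poly_exists[of z] a(3) by metis
      have deg: "0 < Polynomial.degree g" "Polynomial.degree g < m l"
        using g a \<phi>(3) dvd_imp_degree_le[of g a] degree_pos_if_root[of g z] by auto
      \<comment> \<open>No degree lies strictly between 0 and \<open>m 0\<close>, so
        \<open>l\<close> is positive and level \<open>l - 1\<close> exists.\<close>
      have "m 0 = 1"
        using frame by (simp add: okutsu_frame_def)
      with deg obtain k where k: "l = Suc k"
        by (cases l) auto
      \<comment> \<open>Level \<open>k\<close> bounds the weight of \<open>g\<close>, and (OF3) puts
        this bound strictly below the weight of \<phi>; the closeness of \<open>z\<close> to
        \<theta> gives the opposite inequality.\<close>
      then obtain p where p: "p \<in> \<Phi> ! k" "wt v F g \<le> wt v F p"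
        using best[of k g] g(1) deg l by auto
      have "wt v F p < wt v F \<phi>"
        using incr[of k p \<phi>] p(1) in\<Phi>(1) l k by simp
      moreover have "wt v F \<phi> \<le> wt v F g"
        using F \<phi>(1,2) x x_max g(1-3) near unfolding \<theta>_def by (intro wt_mono[of F \<phi> x g z]) auto
      ultimately show False
        using p(2) by simp
    qed
  qed
  then show ?thesis
    by (simp add: \<phi>(3) \<psi>(3))
qed

end

theorem corollary4p6:
  fixes v :: "'a::field \<Rightarrow> 'g::linordered_ab_group_add extended"
    and F :: "'a poly"
    and r :: nat
    and \<Phi> :: "'a poly set list"
    and m :: "nat \<Rightarrow> nat"
  assumes "henselian v"
    and "Polynomial.lead_coeff F = 1"
    and "Factorial_Ring.irreducible F"
    and "Polynomial.degree F > 1"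
    and "okutsu_frame v F r \<Phi> m"
  shows "m 0 = 1 \<and> (\<forall>l<r. m l dvd m (l + 1)) \<and> m r dvd Polynomial.degree F"
proof -
  interpret henselian_field v
    using assms(1) by unfold_locales
  \<comment> \<open>The case \<open>l = r\<close> yields the divisor of the degree of
    \<open>F\<close>, since \<open>\<Phi> ! (r + 1)\<close> is \<open>{F}\<close>.\<close>
  have step: "m l dvd m (l + 1)" if "l \<le> r" for l
    using assms(2,3,5) that by (rule okutsu_frame_step)
  have "m 0 = 1" and "F \<in> \<Phi> ! (r + 1)"
    using assms(5) by (simp_all add: okutsu_frame_def)
  moreover from this(2) have "m (r + 1) = Polynomial.degree F"
    using assms(5) unfolding okutsu_frame_def by (metis order.refl)
  ultimately show ?thesis
    using step step[of r] by auto
qed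

end
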